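(* Let $0<\alpha<1$, $0<\theta<1$, $0<\Lambda<1$ and $I=[1-\theta,1-\Lambda\theta]$. Let $\Phi:I\to I$ be defined by $$\Phi(v_0)=P\left(1-\theta+(1-\Lambda)\int_0^{R(v_0)}e^{-c(v_0)s}\big(-v'(v_0;s)\big)\,ds\right).$$ Then $\Phi$ has a fixed point $v_0^*\in I$ which solves the integro-differential system: $(c,R,v)=(c(v_0^* ),R(v_0^* ),v(v_0^*;\cdot))$, with $v(0)=v_0^*$, satisfies $$\begin{cases}\Lambda v''-cv'=v^\alpha,\quad 0<\xi<R,\\ 0<v(0)<1,\quad v'(0)=-\dfrac{c}{\Lambda}(1-v(0)),\\ v(R)=v'(R)=0,\end{cases}$$ together with $$\theta+v(0)=1-(1-\Lambda)\int_0^R e^{-cs}v'(s)\,ds.$$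
   Context: For $v_0\in(0,1)$, $(c(v_0),R(v_0),v(v_0;\xi))$ denotes the unique solution, with $c>0$, $0<R<+\infty$, $v\ge0$, $v\in C^\infty([0,R))\cap C^1([0,R])$, of the free boundary problem $\Lambda v''-cv'=v^\alpha$ on $(0,R)$, $v(0)=v_0$, $v'(0)=-\frac{c}{\Lambda}(1-v_0)$, $v(R)=v'(R)=0$; $v'(v_0;s)$ is the derivative in $s$. For $I=[a,b]$, $P:\mathbb{R}\to I$ is the projection $P(x)=x$ if $a<x<b$, $P(x)=a$ if $x\le a$, $P(x)=b$ if $x\ge b$. *)

theory Defs
  imports "HOL-Analysis.Analysis"
begin

text \<open>Derivative of a function regarded as a function on \<open>[0,R]\<close>: one-sided at the two end points,
  the ordinary derivative in between.\<close>

definition deriv_on :: "real \<Rightarrow> (real \<Rightarrow> real) \<Rightarrow> real \<Rightarrow> real" where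
  "deriv_on R f s = vector_derivative f (at s within {0..R})"

definition C1_on :: "real \<Rightarrow> (real \<Rightarrow> real) \<Rightarrow> bool" where
  "C1_on R f \<longleftrightarrow> f differentiable_on {0..R} \<and> continuous_on {0..R} (deriv_on R f)"

text \<open>\<open>C\<^sup>\<infinity>(S)\<close>, with one-sided derivatives at a boundary point belonging to \<open>S\<close>;
  \<open>D k\<close> is the \<open>k\<close>-th derivative.\<close>

definition Cinfinity_on :: "real set \<Rightarrow> (real \<Rightarrow> real) \<Rightarrow> bool" where
  "Cinfinity_on S f \<longleftrightarrow>
     (\<exists>D :: nat \<Rightarrow> real \<Rightarrow> real. D 0 = f \<and>
        (\<forall>k. \<forall>x\<in>S. (D k has_real_derivative D (Suc k) x) (at x within S)))"

definition admissible :: "real \<Rightarrow> real \<Rightarrow> (real \<Rightarrow> real) \<Rightarrow> bool" where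
  "admissible c R v \<longleftrightarrow>
     c > 0 \<and> R > 0 \<and> (\<forall>x\<in>{0..R}. v x \<ge> 0) \<and> Cinfinity_on {0..<R} v \<and> C1_on R v"

definition satisfies_ode :: "real \<Rightarrow> real \<Rightarrow> real \<Rightarrow> real \<Rightarrow> (real \<Rightarrow> real) \<Rightarrow> bool" where
  "satisfies_ode \<alpha> \<Lambda> c R v \<longleftrightarrow>
     (\<forall>\<xi>\<in>{0<..<R}. \<Lambda> * deriv_on R (deriv_on R v) \<xi> - c * deriv_on R v \<xi> = v \<xi> powr \<alpha>)"

definition free_boundary_solution ::
  "real \<Rightarrow> real \<Rightarrow> real \<Rightarrow> real \<Rightarrow> real \<Rightarrow> (real \<Rightarrow> real) \<Rightarrow> bool" where
  "free_boundary_solution \<alpha> \<Lambda> v0 c R v \<longleftrightarrow>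
     admissible c R v \<and> satisfies_ode \<alpha> \<Lambda> c R v \<and>
     v 0 = v0 \<and> deriv_on R v 0 = - (c / \<Lambda>) * (1 - v0) \<and>
     v R = 0 \<and> deriv_on R v R = 0"

text \<open>The unique solution. A profile is only meaningful on \<open>[0,R]\<close>; setting it to zero elsewhere
  makes it unique as a total function.\<close>

definition the_solution :: "real \<Rightarrow> real \<Rightarrow> real \<Rightarrow> real \<times> real \<times> (real \<Rightarrow> real)" where
  "the_solution \<alpha> \<Lambda> v0 =
     (THE (c, R, v). free_boundary_solution \<alpha> \<Lambda> v0 c R v \<and> (\<forall>x. x \<notin> {0..R} \<longrightarrow> v x = 0))"

definition sol_c :: "real \<Rightarrow> real \<Rightarrow> real \<Rightarrow> real" where
  "sol_c \<alpha> \<Lambda> v0 = fst (the_solution \<alpha> \<Lambda> v0)"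

definition sol_R :: "real \<Rightarrow> real \<Rightarrow> real \<Rightarrow> real" where
  "sol_R \<alpha> \<Lambda> v0 = fst (snd (the_solution \<alpha> \<Lambda> v0))"

definition sol_v :: "real \<Rightarrow> real \<Rightarrow> real \<Rightarrow> real \<Rightarrow> real" where
  "sol_v \<alpha> \<Lambda> v0 = snd (snd (the_solution \<alpha> \<Lambda> v0))"

definition interval_proj :: "real \<Rightarrow> real \<Rightarrow> real \<Rightarrow> real" where
  "interval_proj a b x = (if x \<le> a then a else if x \<ge> b then b else x)"

definition Phi :: "real \<Rightarrow> real \<Rightarrow> real \<Rightarrow> real \<Rightarrow> real" where
  "Phi \<alpha> \<Lambda> \<theta> v0 =
     interval_proj (1 - \<theta>) (1 - \<Lambda> * \<theta>)
       (1 - \<theta> + (1 - \<Lambda>) *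
         integral {0..sol_R \<alpha> \<Lambda> v0}
           (\<lambda>s. exp (- sol_c \<alpha> \<Lambda> v0 * s) *
                (- deriv_on (sol_R \<alpha> \<Lambda> v0) (sol_v \<alpha> \<Lambda> v0) s)))"

definition integro_differential_solution ::
  "real \<Rightarrow> real \<Rightarrow> real \<Rightarrow> real \<Rightarrow> real \<Rightarrow> (real \<Rightarrow> real) \<Rightarrow> bool" where
  "integro_differential_solution \<alpha> \<Lambda> \<theta> c R v \<longleftrightarrow>
     admissible c R v \<and> satisfies_ode \<alpha> \<Lambda> c R v \<and>
     0 < v 0 \<and> v 0 < 1 \<and> deriv_on R v 0 = - (c / \<Lambda>) * (1 - v 0) \<and>
     v R = 0 \<and> deriv_on R v R = 0 \<and>
     \<theta> + v 0 = 1 - (1 - \<Lambda>) * integral {0..R} (\<lambda>s. exp (- c * s) * deriv_on R v s)"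

end

theory Submission
  imports Defs
begin

text \<open>
  Reversing time and rescaling, \<open>v s = A * U (c * (R - s))\<close> with \<open>A = c powr (- 2 / (1 - \<alpha>))\<close>, turns every
  free boundary problem into the single problem \<open>\<Lambda> U'' + U' = U powr \<alpha>\<close>, \<open>U 0 = U' 0 = 0\<close>, \<open>U > 0\<close>
  on the half-line. It has exactly one solution: existence is by monotone iteration between two
  multiples of \<open>t powr (2 / (1 - \<alpha>))\<close>, uniqueness by sublinearity of the source. With
  \<open>F = \<Lambda> U' + U\<close> and \<open>\<rho> = c * R\<close>, the condition at \<open>0\<close> says \<open>A * F \<rho> = 1\<close>, so that
  \<open>v0 = U \<rho> / F \<rho>\<close>. This ratio is strictly increasing in \<open>\<rho>\<close>, hence \<open>v0\<close> determines \<open>\<rho>\<close>,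
  \<open>c\<close> and \<open>R\<close>. Parametrising by \<open>\<rho>\<close> instead of \<open>v0\<close>, the unprojected fixed point equation is a
  continuous scalar equation solved by the intermediate value theorem, and \<open>U'' \<ge> 0\<close> places its
  solution inside the interval, where the projection is the identity.
\<close>

section \<open>Real analysis\<close>

lemma nondecreasing_of_deriv_nonneg:
  fixes f f' :: "real \<Rightarrow> real"
  assumes "continuous_on {a..b} f"
    and "\<And>t. a < t \<Longrightarrow> t < b \<Longrightarrow> (f has_real_derivative f' t) (at t)"
    and "\<And>t. a < t \<Longrightarrow> t < b \<Longrightarrow> 0 \<le> f' t"
    and "a \<le> s" "s \<le> t" "t \<le> b"
  shows "f s \<le> f t"
proof (rule DERIV_nonneg_imp_increasing_open[of s t f])
  show "continuous_on {s..t} f"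
    using assms by (auto intro: continuous_on_subset)
  show "\<exists>y. DERIV f x :> y \<and> 0 \<le> y" if "s < x" "x < t" for x
    using assms(2,3)[of x] that assms(4-6) by (intro exI[of _ "f' x"]) auto
qed (use assms in auto)

lemma increasing_of_deriv_pos:
  fixes f f' :: "real \<Rightarrow> real"
  assumes "continuous_on {a..b} f"
    and "\<And>t. a < t \<Longrightarrow> t < b \<Longrightarrow> (f has_real_derivative f' t) (at t)"
    and "\<And>t. a < t \<Longrightarrow> t < b \<Longrightarrow> 0 < f' t"
    and "a \<le> s" "s < t" "t \<le> b"
  shows "f s < f t"
proof (rule DERIV_pos_imp_increasing_open[of s t f])
  show "continuous_on {s..t} f"
    using assms by (auto intro: continuous_on_subset)
  show "\<exists>y. DERIV f x :> y \<and> 0 < y" if "s < x" "x < t" for x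
    using assms(2,3)[of x] that assms(4-6) by (intro exI[of _ "f' x"]) auto
qed (use assms in auto)

text \<open>The equation is \<open>\<Lambda> * x' + x = r\<close>; the integrating factor
  \<open>exp (t / \<Lambda>)\<close> turns it into a derivative that is a positive multiple of
  \<open>r\<close>.\<close>

lemma nonneg_of_relaxation:
  fixes x r :: "real \<Rightarrow> real"
  assumes "continuous_on {0..T} x" "0 < \<Lambda>"
    and "\<And>t. 0 < t \<Longrightarrow> t < T \<Longrightarrow> (x has_real_derivative (r t - x t) / \<Lambda>) (at t)"
    and "\<And>t. 0 < t \<Longrightarrow> t < T \<Longrightarrow> 0 \<le> r t"
    and "0 \<le> x 0" "0 \<le> t" "t \<le> T"
  shows "0 \<le> x t"
proof -
  have "exp (0 / \<Lambda>) * x 0 \<le> exp (t / \<Lambda>) * x t"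
  proof (rule nondecreasing_of_deriv_nonneg[where f = "\<lambda>t. exp (t / \<Lambda>) * x t"
        and f' = "\<lambda>t. exp (t / \<Lambda>) * r t / \<Lambda>"])
    show "((\<lambda>t. exp (t / \<Lambda>) * x t) has_real_derivative exp (t / \<Lambda>) * r t / \<Lambda>) (at t)"
      if "0 < t" "t < T" for t
      using assms(2) by (auto intro!: derivative_eq_intros assms(3) that simp: field_simps)
  qed (use assms in \<open>auto intro!: continuous_intros\<close>)
  with assms(5) have "0 \<le> exp (t / \<Lambda>) * x t" by simp
  then show ?thesis by (simp add: zero_le_mult_iff)
qed

lemma pos_of_relaxation:
  fixes x r :: "real \<Rightarrow> real"
  assumes "continuous_on {0..T} x" "0 < \<Lambda>"
    and "\<And>t. 0 < t \<Longrightarrow> t < T \<Longrightarrow> (x has_real_derivative (r t - x t) / \<Lambda>) (at t)"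
    and "\<And>t. 0 < t \<Longrightarrow> t < T \<Longrightarrow> 0 < r t"
    and "0 \<le> x 0" "0 < t" "t \<le> T"
  shows "0 < x t"
proof -
  have "exp (0 / \<Lambda>) * x 0 < exp (t / \<Lambda>) * x t"
  proof (rule increasing_of_deriv_pos[where f = "\<lambda>t. exp (t / \<Lambda>) * x t"
        and f' = "\<lambda>t. exp (t / \<Lambda>) * r t / \<Lambda>"])
    show "((\<lambda>t. exp (t / \<Lambda>) * x t) has_real_derivative exp (t / \<Lambda>) * r t / \<Lambda>) (at t)"
      if "0 < t" "t < T" for t
      using assms(2) by (auto intro!: derivative_eq_intros assms(3) that simp: field_simps)
  qed (use assms in \<open>auto intro!: continuous_intros\<close>)
  with assms(5) have "0 < exp (t / \<Lambda>) * x t" by simp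
  then show ?thesis by (simp add: zero_less_mult_iff)
qed

lemma continuous_on_atLeast_of_Icc:
  fixes f :: "real \<Rightarrow> real"
  assumes "\<And>T. continuous_on {0..T} f"
  shows "continuous_on {0..} f"
  unfolding continuous_on_eq_continuous_within
proof
  fix x :: real assume x: "x \<in> {0..}"
  have "at x within {0..} = at x within {0..x + 1}"
    by (rule at_within_nhd[of _ "{..<x + 1}"]) (use x in auto)
  then show "continuous (at x within {0..}) f"
    using assms[of "x + 1"] x by (simp add: continuous_on_eq_continuous_within)
qed

text \<open>Antiderivatives on the whole line keep later derivatives two-sided, also at time
  0.\<close>

lemma antiderivative_UNIV:
  fixes f :: "real \<Rightarrow> real"
  assumes "continuous_on UNIV f"
  obtains F where "F 0 = 0" "\<And>t. (F has_real_derivative f t) (at t)"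
    "\<And>t. 0 \<le> t \<Longrightarrow> integral {0..t} f = F t"
proof -
  obtain G where G: "\<And>t. (G has_real_derivative f t) (at t)"
    using einterval_antiderivative[of "-\<infinity>" "\<infinity>" f] assms
    by (auto simp: has_real_derivative_iff_has_vector_derivative continuous_on_eq_continuous_at)
  define F where "F = (\<lambda>t. G t - G 0)"
  have F: "(F has_real_derivative f t) (at t)" for t
    unfolding F_def by (auto intro!: derivative_eq_intros G)
  moreover have "integral {0..t} f = F t" if "0 \<le> t" for t
  proof -
    have "(f has_integral F t - F 0) {0..t}"
      using that F by (intro fundamental_theorem_of_calculus)
        (auto simp: has_real_derivative_iff_has_vector_derivative[symmetric] intro: DERIV_subset)
    then show ?thesis by (simp add: integral_unique F_def)
  qed
  ultimately show thesis using that[of F] by (simp add: F_def)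
qed

text \<open>Serves sources that are extended by zero to negative times.\<close>

lemma vanishes_on_negatives:
  fixes f F :: "real \<Rightarrow> real"
  assumes "F 0 = 0" "\<And>t. (F has_real_derivative f t) (at t)" "\<And>t. t < 0 \<Longrightarrow> f t = 0" "t \<le> 0"
  shows "F t = 0"
proof -
  have c: "continuous_on {t..0} F"
    using assms(2) by (intro DERIV_continuous_on) (auto intro: DERIV_subset)
  have "F t = F 0"
  proof (cases "t = 0")
    case False
    then show ?thesis
      using assms DERIV_isconst2[of t 0 F 0] c by (metis order_le_less order_refl)
  qed simp
  then show ?thesis using assms by simp
qed

text \<open>By continuity from the right all derivatives vanish at \<open>p\<close>, so Taylor's
  formula of order \<open>n\<close> at \<open>p\<close> consists of its remainder alone.\<close>

lemma smooth_flat_bound: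
  fixes D :: "nat \<Rightarrow> real \<Rightarrow> real"
  assumes ab: "a < p" "p < b" and n: "0 < n"
    and D: "\<And>k x. a < x \<Longrightarrow> x < b \<Longrightarrow> (D k has_real_derivative D (Suc k) x) (at x)"
    and flat: "\<And>x. p < x \<Longrightarrow> x < b \<Longrightarrow> D 0 x = 0"
  shows "\<exists>M d. 0 < d \<and> (\<forall>h. 0 < h \<longrightarrow> h < d \<longrightarrow> \<bar>D 0 (p - h)\<bar> \<le> M * h ^ n)"
proof -
  have zero: "D k x = 0" if "p < x" "x < b" for k x
    using that
  proof (induction k arbitrary: x)
    case 0
    then show ?case by (rule flat)
  next
    case (Suc k)
    have "(D k has_real_derivative 0) (at x)"
      by (rule has_field_derivative_transform_within_open[of "\<lambda>_. 0" _ _ "{p<..<b}"])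
        (use Suc in auto)
    then show ?case
      using D[of x k] Suc.prems ab by (meson DERIV_unique less_trans)
  qed
  have zero_p: "D k p = 0" for k
  proof -
    have "isCont (D k) p" using D[of p k] ab DERIV_isCont by blast
    then have "(D k \<longlongrightarrow> D k p) (at_right p)"
      by (simp add: continuous_at filterlim_at_split)
    moreover have "\<forall>\<^sub>F x in at_right p. D k x = 0"
      using ab zero by (auto simp: eventually_at_right_field)
    then have "(D k \<longlongrightarrow> 0) (at_right p)"
      by (rule tendsto_eventually)
    ultimately show ?thesis
      using tendsto_unique trivial_limit_at_right_real by blast
  qed
  \<comment> \<open>Stepping away from \<open>a\<close> gives a compact interval
    \<open>{q..p}\<close> on which \<open>D n\<close> is bounded.\<close>
  define q where "q = (a + p) / 2"
  have q: "a < q" "q < p" using ab by (auto simp: q_def)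
  have "continuous_on {q..p} (D n)"
    by (rule DERIV_continuous_on, rule DERIV_subset[OF D]) (use q ab in auto)
  then have "bounded (D n ` {q..p})"
    using compact_continuous_image compact_imp_bounded by blast
  then obtain M where "\<forall>x\<in>D n ` {q..p}. norm x \<le> M"
    using bounded_iff by blast
  then have M: "\<bar>D n x\<bar> \<le> M" if "q \<le> x" "x \<le> p" for x
    using that by simp
  have "\<bar>D 0 (p - h)\<bar> \<le> M * h ^ n" if h: "0 < h" "h < p - q" for h
  proof -
    have "\<exists>t>p - h. t < p \<and>
      D 0 (p - h) = (\<Sum>m<n. D m p / fact m * ((p - h) - p) ^ m) + D n t / fact n * ((p - h) - p) ^ n"
    proof (rule Taylor_down[where b = p])
      show "\<forall>m t. m < n \<and> p - h \<le> t \<and> t \<le> p \<longrightarrow> (D m has_real_derivative D (Suc m) t) (at t)"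
        using h q ab by (auto intro!: D)
    qed (use n h in auto)
    then obtain t where t: "p - h < t" "t < p" "D 0 (p - h) = D n t / fact n * (- h) ^ n"
      by (auto simp: zero_p)
    have "\<bar>D 0 (p - h)\<bar> = \<bar>D n t\<bar> / fact n * h ^ n"
      using h by (simp add: t(3) abs_mult power_abs)
    also have "\<dots> \<le> \<bar>D n t\<bar> / 1 * h ^ n"
      using h by (intro mult_right_mono divide_left_mono) auto
    also have "\<dots> \<le> M * h ^ n"
      using M[of t] t h by (intro mult_right_mono) auto
    finally show ?thesis .
  qed
  then show ?thesis using q by (intro exI[of _ M] exI[of _ "p - q"]) auto
qed

lemma deriv_on_eq:
  assumes "(f has_real_derivative d) (at s within {0..R})" "0 < R" "0 \<le> s" "s \<le> R"
  shows "deriv_on R f s = d"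
  unfolding deriv_on_def
  using assms by (intro vector_derivative_within_closed_interval)
    (auto simp: has_real_derivative_iff_has_vector_derivative)

section \<open>Uniqueness of the profile\<close>

locale combustion =
  fixes \<alpha> \<Lambda> :: real
  assumes \<alpha>: "0 < \<alpha>" "\<alpha> < 1" and \<Lambda>: "0 < \<Lambda>" "\<Lambda> < 1"
begin

text \<open>First-order form of \<open>\<Lambda> * u'' + u' = u powr \<alpha>\<close> with
  \<open>y = \<Lambda> * u' + u\<close>. Initial values are left free so that time shifts stay in
  the class, and \<open>u\<close> may rest at zero for a while.\<close>

definition profile_on :: "real \<Rightarrow> (real \<Rightarrow> real) \<Rightarrow> (real \<Rightarrow> real) \<Rightarrow> bool" where
  "profile_on T u y \<longleftrightarrow> continuous_on {0..T} u \<and> continuous_on {0..T} y \<and>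
     (\<forall>t. 0 < t \<longrightarrow> t < T \<longrightarrow> (u has_real_derivative (y t - u t) / \<Lambda>) (at t)) \<and>
     (\<forall>t. 0 < t \<longrightarrow> t < T \<longrightarrow> (y has_real_derivative u t powr \<alpha>) (at t)) \<and>
     (\<forall>t\<in>{0..T}. 0 \<le> u t)"

lemma profile_onD:
  assumes "profile_on T u y"
  shows "continuous_on {0..T} u" "continuous_on {0..T} y"
    "\<And>t. 0 < t \<Longrightarrow> t < T \<Longrightarrow> (u has_real_derivative (y t - u t) / \<Lambda>) (at t)"
    "\<And>t. 0 < t \<Longrightarrow> t < T \<Longrightarrow> (y has_real_derivative u t powr \<alpha>) (at t)"
    "\<And>t. 0 \<le> t \<Longrightarrow> t \<le> T \<Longrightarrow> 0 \<le> u t"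
  using assms by (auto simp: profile_on_def)

lemma profile_on_shift:
  assumes "profile_on T u y" "0 \<le> e" "e \<le> T"
  shows "profile_on (T - e) (\<lambda>t. u (t + e)) (\<lambda>t. y (t + e))"
proof -
  have "continuous_on {0..T - e} (\<lambda>t. u (t + e))" "continuous_on {0..T - e} (\<lambda>t. y (t + e))"
    using assms profile_onD(1,2)[OF assms(1)]
    by (auto intro!: continuous_on_compose2[of "{0..T}" u] continuous_on_compose2[of "{0..T}" y]
        continuous_intros)
  moreover have "((\<lambda>t. f (t + e)) has_real_derivative D) (at t)"
    if "(f has_real_derivative D) (at (t + e))" for f D t
    using that by (simp add: DERIV_shift)
  ultimately show ?thesis
    using assms(2,3) profile_onD[OF assms(1)] by (simp add: profile_on_def)
qed

text \<open>The difference \<open>y - u\<close> is \<open>\<Lambda> * u'\<close>, and it relaxes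
  towards the nonnegative source \<open>\<Lambda> * u powr \<alpha>\<close>.\<close>

lemma profile_on_slope_nonneg:
  assumes "profile_on T u y" "u 0 \<le> y 0" "0 \<le> t" "t \<le> T"
  shows "u t \<le> y t"
proof -
  have "0 \<le> y t - u t"
  proof (rule nonneg_of_relaxation[where T = T and \<Lambda> = \<Lambda>
        and x = "\<lambda>t. y t - u t" and r = "\<lambda>t. \<Lambda> * u t powr \<alpha>"])
    show "((\<lambda>t. y t - u t) has_real_derivative (\<Lambda> * u t powr \<alpha> - (y t - u t)) / \<Lambda>) (at t)"
      if "0 < t" "t < T" for t
      using \<Lambda> that
      by (auto intro!: derivative_eq_intros profile_onD[OF assms(1)] simp: field_simps)
  qed (use assms \<Lambda> profile_onD[OF assms(1)] in \<open>auto intro!: continuous_intros\<close>)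
  then show ?thesis by simp
qed

lemma profile_on_mono:
  assumes "profile_on T u y" "u 0 \<le> y 0" "0 \<le> s" "s \<le> t" "t \<le> T"
  shows "u s \<le> u t"
  by (rule nondecreasing_of_deriv_nonneg[where a = 0 and b = T and f' = "\<lambda>t. (y t - u t) / \<Lambda>"])
    (use assms \<Lambda> profile_onD[OF assms(1)] profile_on_slope_nonneg[OF assms(1,2)] in auto)

text \<open>A factor \<open>m\<close> between the solutions becomes \<open>m powr \<alpha>\<close>
  between the sources; integrating for \<open>y\<close> and then relaxing for \<open>u\<close>
  passes it back to the solutions.\<close>

lemma profile_on_improve_bound:
  assumes u: "profile_on T u y" and w: "profile_on T w z"
    and "0 < m" "w 0 \<le> 0" "z 0 \<le> 0" "0 \<le> u 0" "0 \<le> y 0"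
    and le: "\<And>t. 0 \<le> t \<Longrightarrow> t \<le> T \<Longrightarrow> m * w t \<le> u t"
    and "0 \<le> t" "t \<le> T"
  shows "m powr \<alpha> * w t \<le> u t"
proof -
  define k where "k = m powr \<alpha>"
  have k: "0 < k" using assms by (simp add: k_def)
  have src: "0 \<le> u s powr \<alpha> - k * w s powr \<alpha>" if "0 \<le> s" "s \<le> T" for s
    using le[OF that] profile_onD(5)[OF w that] assms(3) \<alpha>
    by (auto simp: k_def powr_mult[symmetric] intro!: powr_mono2)
  have Y: "0 \<le> y s - k * z s" if "0 \<le> s" "s \<le> T" for s
  proof -
    have "y 0 - k * z 0 \<le> y s - k * z s"
      by (rule nondecreasing_of_deriv_nonneg[where a = 0 and b = T
            and f' = "\<lambda>s. u s powr \<alpha> - k * w s powr \<alpha>" and f = "\<lambda>s. y s - k * z s"])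
        (use that profile_onD[OF u] profile_onD[OF w] src
          in \<open>auto intro!: continuous_intros derivative_eq_intros\<close>)
    moreover have "k * z 0 \<le> 0" using k assms by (simp add: mult_le_0_iff)
    ultimately show ?thesis using assms by simp
  qed
  have "0 \<le> u t - k * w t"
  proof (rule nonneg_of_relaxation[where T = T and \<Lambda> = \<Lambda>
        and x = "\<lambda>s. u s - k * w s" and r = "\<lambda>s. y s - k * z s"])
    have "k * w 0 \<le> 0" using k assms by (simp add: mult_le_0_iff)
    then show "0 \<le> u 0 - k * w 0" using assms by simp
    show "((\<lambda>s. u s - k * w s) has_real_derivative (y s - k * z s - (u s - k * w s)) / \<Lambda>) (at s)"
      if "0 < s" "s < T" for s
      using \<Lambda> that
      by (auto intro!: derivative_eq_intros profile_onD[OF u] profile_onD[OF w] simp: field_simps)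
  qed (use assms \<Lambda> Y profile_onD[OF u] profile_onD[OF w] in \<open>auto intro!: continuous_intros\<close>)
  then show ?thesis by (simp add: k_def)
qed

text \<open>The source \<open>u powr \<alpha>\<close> is homogeneous of degree \<open>\<alpha> < 1\<close>, so a crude bound \<open>m * w \<le> u\<close>
  improves to \<open>m powr \<alpha> ^ n * w \<le> u\<close> and, as \<open>n\<close> tends to infinity, to \<open>w \<le> u\<close>.\<close>

lemma profile_on_le_of_pos:
  assumes u: "profile_on T u y" and w: "profile_on T w z"
    and 0: "w 0 \<le> 0" "z 0 \<le> 0" "0 \<le> y 0"
    and pos: "\<And>t. 0 \<le> t \<Longrightarrow> t \<le> T \<Longrightarrow> 0 < u t"
    and t: "0 \<le> t" "t \<le> T"
  shows "w t \<le> u t"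
proof -
  obtain a where a: "a \<in> {0..T}" "\<And>s. s \<in> {0..T} \<Longrightarrow> u a \<le> u s"
    using continuous_attains_inf[OF _ _ profile_onD(1)[OF u]] t by fastforce
  obtain b where b: "b \<in> {0..T}" "\<And>s. s \<in> {0..T} \<Longrightarrow> w s \<le> w b"
    using continuous_attains_sup[OF _ _ profile_onD(1)[OF w]] t by fastforce
  \<comment> \<open>Adding 1 keeps the denominator positive even if \<open>w\<close> vanishes
    identically.\<close>
  define m where "m = u a / (1 + w b)"
  have "0 \<le> w b" using profile_onD(5)[OF w] b(1) by auto
  have m: "0 < m" using pos[of a] a(1) \<open>0 \<le> w b\<close> by (auto simp: m_def)
  have it: "m powr (\<alpha> ^ n) * w s \<le> u s" if "0 \<le> s" "s \<le> T" for n s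
    using that
  proof (induction n arbitrary: s)
    case 0
    have "m * w s \<le> m * (1 + w b)" using b(2)[of s] 0 m by (intro mult_left_mono) auto
    also have "\<dots> = u a" using \<open>0 \<le> w b\<close> by (simp add: m_def)
    also have "\<dots> \<le> u s" using a(2)[of s] 0 by simp
    finally show ?case using m by simp
  next
    case (Suc n)
    have "(m powr (\<alpha> ^ n)) powr \<alpha> * w s \<le> u s"
      by (rule profile_on_improve_bound[OF u w]) (use m 0 pos[of 0] Suc t in auto)
    then show ?case by (simp add: powr_powr mult.commute)
  qed
  have "(\<lambda>n. m powr (\<alpha> ^ n) * w t) \<longlonglongrightarrow> m powr 0 * w t"
    using \<alpha> m by (intro tendsto_intros LIMSEQ_power_zero) auto
  then have "m powr 0 * w t \<le> u t"
    by (rule LIMSEQ_le_const2) (use it[OF t] in auto)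
  then show ?thesis using m by simp
qed

text \<open>Every positive time shift of \<open>u\<close> starts strictly positive, hence dominates \<open>w\<close>.\<close>

lemma profile_on_le:
  assumes u: "profile_on T u y" and w: "profile_on T w z"
    and 0: "w 0 = 0" "z 0 = 0" "u 0 = 0" "y 0 = 0"
    and pos: "\<And>t. 0 < t \<Longrightarrow> t \<le> T \<Longrightarrow> 0 < u t"
    and t: "0 < t" "t \<le> T"
  shows "w t \<le> u t"
proof -
  have le: "w (t - e) \<le> u t" if e: "0 < e" "e < t" for e
  proof -
    have "profile_on (T - e) w z"
      using w e t by (auto simp: profile_on_def intro: continuous_on_subset)
    moreover have "0 \<le> y (0 + e)"
      using profile_on_slope_nonneg[OF u, of e] pos[of e] 0 e t by auto
    ultimately have "w (t - e) \<le> u (t - e + e)"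
      by (intro profile_on_le_of_pos[OF profile_on_shift[OF u]]) (use 0 pos e t in auto)
    then show ?thesis by simp
  qed
  \<comment> \<open>Only the argument of \<open>w\<close> depends on the shift \<open>e\<close>, so
    continuity of \<open>w\<close> allows \<open>e\<close> to tend to 0.\<close>
  have "((\<lambda>e. w (t - e)) \<longlongrightarrow> w (t - 0)) (at 0 within {0..t})"
  proof -
    have "continuous_on {0..t} (\<lambda>e. w (t - e))"
      using profile_onD(1)[OF w] t
      by (auto intro!: continuous_on_compose2[of "{0..T}" w] continuous_intros)
    then show ?thesis
      unfolding continuous_on_def by (rule bspec) (use t in auto)
  qed
  moreover have "\<forall>\<^sub>F e in at 0 within {0..t}. w (t - e) \<le> u t"
  proof -
    have "\<forall>\<^sub>F e in at 0 within {0..t}. e < t"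
      using t by (intro order_tendstoD(2)[OF tendsto_ident_at]) auto
    moreover have "\<forall>\<^sub>F e in at 0 within {0..t}. e \<in> {0..t} - {0}"
      by (auto simp: eventually_at_filter)
    ultimately show ?thesis
      by eventually_elim (use le in auto)
  qed
  moreover have "at 0 within {0..t} \<noteq> bot"
    using t by (simp add: at_within_Icc_at_right)
  ultimately show ?thesis
    using tendsto_upperbound by fastforce
qed

text \<open>\<open>profile_on_le\<close> in both directions identifies \<open>u\<close> and
  \<open>w\<close>; then \<open>y\<close> and \<open>z\<close> share derivative and initial
  value.\<close>

lemma profile_on_unique:
  assumes u: "profile_on T u y" and w: "profile_on T w z"
    and 0: "w 0 = 0" "z 0 = 0" "u 0 = 0" "y 0 = 0"
    and pos: "\<And>t. 0 < t \<Longrightarrow> t \<le> T \<Longrightarrow> 0 < u t" "\<And>t. 0 < t \<Longrightarrow> t \<le> T \<Longrightarrow> 0 < w t"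
    and t: "0 \<le> t" "t \<le> T"
  shows "u t = w t" "y t = z t"
proof -
  have eq: "u t = w t" if "0 \<le> t" "t \<le> T" for t
    using profile_on_le[OF u w 0 pos(1), of t] profile_on_le[OF w u 0(3,4,1,2) pos(2), of t] that 0
    by (cases "t = 0") (auto intro: antisym)
  then show "u t = w t" using t .
  have "y 0 - z 0 \<le> y t - z t"
    by (rule nondecreasing_of_deriv_nonneg[where a = 0 and b = T and f' = "\<lambda>s. 0" and f = "\<lambda>t. y t - z t"])
      (use t eq DERIV_diff[OF profile_onD(4)[OF u] profile_onD(4)[OF w]] profile_onD(2)[OF u] profile_onD(2)[OF w]
          in \<open>auto intro!: continuous_intros\<close>)
  moreover have "z 0 - y 0 \<le> z t - y t"
    by (rule nondecreasing_of_deriv_nonneg[where a = 0 and b = T and f' = "\<lambda>s. 0" and f = "\<lambda>t. z t - y t"])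
      (use t eq DERIV_diff[OF profile_onD(4)[OF w] profile_onD(4)[OF u]] profile_onD(2)[OF u] profile_onD(2)[OF w]
          in \<open>auto intro!: continuous_intros\<close>)
  ultimately show "y t = z t" using 0 by simp
qed

section \<open>Existence of the profile\<close>

text \<open>Balancing \<open>u''\<close> against \<open>u powr \<alpha>\<close> for a power
  \<open>t powr p\<close> forces \<open>p - 2 = p * \<alpha>\<close>, that is
  \<open>p = 2 * expo\<close>.\<close>

definition expo :: real where "expo = 1 / (1 - \<alpha>)"

lemma expo: "0 < expo" "expo * \<alpha> + 1 = expo"
  using \<alpha> by (auto simp: expo_def field_simps)

text \<open>Taken at \<open>q = k * t\<^sup>2\<close>, this closes both barrier estimates.\<close>

lemma powr_expo:
  assumes "0 \<le> q"
  shows "(q powr expo) powr \<alpha> * q = q powr expo"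
proof -
  have "(q powr expo) powr \<alpha> * q = q powr (expo * \<alpha> + 1)"
    using assms by (cases "q = 0") (simp_all add: powr_powr powr_add)
  then show ?thesis by (simp only: expo)
qed

text \<open>Green function of \<open>\<Lambda> * u'' + u'\<close> with zero data at time 0.\<close>

definition kernel :: "real \<Rightarrow> real \<Rightarrow> real" where
  "kernel t s = 1 - exp ((s - t) / \<Lambda>)"

definition picard :: "(real \<Rightarrow> real) \<Rightarrow> real \<Rightarrow> real" where
  "picard u t = integral {0..t} (\<lambda>s. kernel t s * u s powr \<alpha>)"

lemma kernel_nonneg: "s \<le> t \<Longrightarrow> 0 \<le> kernel t s"
  using \<Lambda> by (auto simp: kernel_def divide_nonpos_nonneg)

lemma kernel_upper: "kernel t s \<le> (t - s) / \<Lambda>"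
  using exp_ge_add_one_self[of "(s - t) / \<Lambda>"] unfolding kernel_def
  unfolding diff_divide_distrib by linarith

text \<open>Rests on \<open>x / (1 + x) \<le> 1 - exp (- x)\<close> for
  \<open>x = t / (2 * \<Lambda>)\<close>. The kernel stays below 1, so a bound linear in
  \<open>t\<close> needs a constant depending on \<open>T\<close>.\<close>

lemma kernel_lower:
  assumes "0 \<le> s" "s \<le> t / 2" "t \<le> T"
  shows "t / (2 * (\<Lambda> + T)) \<le> kernel t s"
proof -
  define x where "x = t / (2 * \<Lambda>)"
  have x: "0 \<le> x" using assms \<Lambda> by (simp add: x_def)
  have "t / (2 * (\<Lambda> + T)) \<le> t / (2 * (\<Lambda> + t / 2))"
    using assms \<Lambda> by (intro divide_left_mono) (auto intro!: mult_pos_pos add_pos_nonneg)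
  also have "\<dots> = x / (1 + x)"
    using \<Lambda> assms by (simp add: x_def field_simps)
  also have "\<dots> = 1 - 1 / (1 + x)" using x by (simp add: field_simps)
  also have "\<dots> \<le> 1 - 1 / exp x"
    using x exp_ge_add_one_self[of x] by (intro diff_left_mono divide_left_mono) auto
  also have "\<dots> = 1 - exp (- x)" by (simp add: exp_minus field_simps)
  also have "\<dots> \<le> kernel t s"
  proof -
    have "x \<le> (t - s) / \<Lambda>" using assms \<Lambda> by (simp add: x_def field_simps)
    then show ?thesis by (simp add: kernel_def diff_divide_distrib)
  qed
  finally show ?thesis .
qed

lemma source_continuous:
  assumes "continuous_on S u" "\<And>s. s \<in> S \<Longrightarrow> 0 \<le> u s"
  shows "continuous_on S (\<lambda>s. u s powr \<alpha>)"
  using assms \<alpha> by (intro continuous_on_powr') (auto intro!: continuous_intros)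

lemma kernel_source_continuous:
  assumes "continuous_on S u" "\<And>s. s \<in> S \<Longrightarrow> 0 \<le> u s"
  shows "continuous_on S (\<lambda>s. kernel t s * u s powr \<alpha>)"
  unfolding kernel_def
  using source_continuous[OF assms] \<Lambda> by (auto intro!: continuous_intros)

text \<open>Factoring the exponential separates \<open>t\<close> from the integration variable and
  leaves indefinite integrals. Integrability is the right assumption because the formula is applied
  to a limit not yet known to be continuous.\<close>

lemma picard_split:
  assumes "(\<lambda>s. u s powr \<alpha>) integrable_on {0..t}"
    and "(\<lambda>s. exp (s / \<Lambda>) * u s powr \<alpha>) integrable_on {0..t}"
  shows "picard u t = integral {0..t} (\<lambda>s. u s powr \<alpha>) -
    exp (- t / \<Lambda>) * integral {0..t} (\<lambda>s. exp (s / \<Lambda>) * u s powr \<alpha>)"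
proof -
  have "kernel t s * u s powr \<alpha> = u s powr \<alpha> - exp (- t / \<Lambda>) * (exp (s / \<Lambda>) * u s powr \<alpha>)" for s
    by (simp add: kernel_def algebra_simps diff_divide_distrib exp_diff exp_minus divide_inverse
        exp_add[symmetric])
  then show ?thesis
    unfolding picard_def using assms
    by (simp add: integral_diff integrable_on_mult_right)
qed

lemma picard_continuous_Icc:
  assumes "(\<lambda>s. u s powr \<alpha>) integrable_on {0..T}"
    and "(\<lambda>s. exp (s / \<Lambda>) * u s powr \<alpha>) integrable_on {0..T}"
  shows "continuous_on {0..T} (picard u)"
proof -
  have "continuous_on {0..T} (\<lambda>t. integral {0..t} (\<lambda>s. u s powr \<alpha>) -
    exp (- t / \<Lambda>) * integral {0..t} (\<lambda>s. exp (s / \<Lambda>) * u s powr \<alpha>))"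
    using assms \<Lambda> by (auto intro!: continuous_intros indefinite_integral_continuous_1)
  moreover have "picard u t = integral {0..t} (\<lambda>s. u s powr \<alpha>) -
    exp (- t / \<Lambda>) * integral {0..t} (\<lambda>s. exp (s / \<Lambda>) * u s powr \<alpha>)" if "t \<in> {0..T}" for t
    using that by (intro picard_split integrable_on_subinterval[OF assms(1)]
        integrable_on_subinterval[OF assms(2)]) auto
  ultimately show ?thesis by (subst continuous_on_cong[OF refl]) auto
qed

lemma picard_continuous:
  assumes "continuous_on {0..} u" "\<And>s. 0 \<le> s \<Longrightarrow> 0 \<le> u s"
  shows "continuous_on {0..} (picard u)"
proof (intro continuous_on_atLeast_of_Icc picard_continuous_Icc integrable_continuous_interval)
  fix T
  have c: "continuous_on {0..T} (\<lambda>s. u s powr \<alpha>)"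
    using assms by (intro source_continuous) (auto intro: continuous_on_subset)
  then show "continuous_on {0..T} (\<lambda>s. u s powr \<alpha>)"
    "continuous_on {0..T} (\<lambda>s. exp (s / \<Lambda>) * u s powr \<alpha>)"
    using \<Lambda> by (auto intro!: continuous_intros)
qed

lemma picard_mono:
  assumes "continuous_on {0..t} u" "continuous_on {0..t} w"
    and "\<And>s. 0 \<le> s \<Longrightarrow> s \<le> t \<Longrightarrow> 0 \<le> u s"
    and "\<And>s. 0 \<le> s \<Longrightarrow> s \<le> t \<Longrightarrow> u s \<le> w s"
  shows "picard u t \<le> picard w t"
  unfolding picard_def
proof (rule integral_le)
  have "0 \<le> w s" if "0 \<le> s" "s \<le> t" for s
    using assms(3,4)[OF that] by simp
  then show "(\<lambda>s. kernel t s * u s powr \<alpha>) integrable_on {0..t}"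
    "(\<lambda>s. kernel t s * w s powr \<alpha>) integrable_on {0..t}"
    using assms by (auto intro!: integrable_continuous_interval kernel_source_continuous)
  show "kernel t s * u s powr \<alpha> \<le> kernel t s * w s powr \<alpha>" if "s \<in> {0..t}" for s
    using that assms \<alpha> by (intro mult_left_mono powr_mono2 kernel_nonneg) auto
qed

lemma picard_nonneg: "0 \<le> picard u t"
\<comment> \<open>The integral of a non-integrable function is 0 by convention.\<close>
proof (cases "(\<lambda>s. kernel t s * u s powr \<alpha>) integrable_on {0..t}")
  case True
  then show ?thesis unfolding picard_def
    by (rule integral_nonneg) (auto intro!: mult_nonneg_nonneg kernel_nonneg)
qed (simp add: picard_def not_integrable_integral)

section \<open>Sub- and supersolutions of order \<open>t powr (2 * expo)\<close>\<close>

definition barrier :: "real \<Rightarrow> real \<Rightarrow> real" where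
  "barrier k t = (k * t\<^sup>2) powr expo"

lemma barrier_continuous: "continuous_on S (barrier k)"
  if "0 < k"
  unfolding barrier_def using expo that by (intro continuous_on_powr') (auto intro!: continuous_intros)

lemma barrier_nonneg: "0 \<le> barrier k t"
  by (simp add: barrier_def)

lemma barrier_mono:
  assumes "0 \<le> k" "k \<le> l" "0 \<le> s" "s \<le> t"
  shows "barrier k s \<le> barrier l t"
  unfolding barrier_def using assms expo by (auto intro!: powr_mono2 mult_mono power_mono)

text \<open>The kernel is at most \<open>t / \<Lambda>\<close>, the barrier is largest at
  \<open>t\<close>, and the interval has length \<open>t\<close>; the resulting factor
  \<open>t\<^sup>2 / \<Lambda>\<close> is absorbed by \<open>powr_expo\<close>.\<close>

lemma picard_upper_barrier:
  assumes "0 \<le> t"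
  shows "picard (barrier (1 / \<Lambda>)) t \<le> barrier (1 / \<Lambda>) t"
proof -
  let ?b = "barrier (1 / \<Lambda>)"
  have "picard ?b t \<le> integral {0..t} (\<lambda>s. t / \<Lambda> * ?b t powr \<alpha>)"
    unfolding picard_def
  proof (rule integral_le)
    show "(\<lambda>s. kernel t s * ?b s powr \<alpha>) integrable_on {0..t}"
      using \<Lambda> by (auto intro!: integrable_continuous_interval kernel_source_continuous
          barrier_continuous barrier_nonneg)
    show "kernel t s * ?b s powr \<alpha> \<le> t / \<Lambda> * ?b t powr \<alpha>" if "s \<in> {0..t}" for s
    proof (rule mult_mono)
      have "(t - s) / \<Lambda> \<le> t / \<Lambda>" using that \<Lambda> by (intro divide_right_mono) auto
      then show "kernel t s \<le> t / \<Lambda>" using kernel_upper[of t s] by linarith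
      show "?b s powr \<alpha> \<le> ?b t powr \<alpha>"
        using that \<alpha> \<Lambda> by (intro powr_mono2 barrier_mono barrier_nonneg) auto
    qed (use assms \<Lambda> in auto)
  qed auto
  also have "\<dots> = ?b t powr \<alpha> * (1 / \<Lambda> * t\<^sup>2)"
    using assms by (simp add: power2_eq_square)
  also have "\<dots> = ?b t"
    using \<Lambda> by (simp only: barrier_def) (rule powr_expo, simp)
  finally show ?thesis .
qed

text \<open>Collects the constants on \<open>{t/4..t/2}\<close>: length \<open>t / 4\<close>, kernel
  at least \<open>t / (2 * (\<Lambda> + T))\<close>, and the factor
  \<open>(1 / 16) powr expo\<close> between the barrier at \<open>t / 4\<close> and at
  \<open>t\<close>, raised to the power \<alpha>.\<close>

definition lower_coeff :: "real \<Rightarrow> real" where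
  "lower_coeff T = (1 / 16) powr (expo * \<alpha>) / (8 * (\<Lambda> + T))"

lemma lower_coeff: "0 \<le> T \<Longrightarrow> 0 < lower_coeff T" "0 \<le> T \<Longrightarrow> lower_coeff T \<le> 1 / \<Lambda>"
proof -
  assume T: "0 \<le> T"
  show "0 < lower_coeff T" using T \<Lambda> by (simp add: lower_coeff_def)
  have "(1 / 16 :: real) powr (expo * \<alpha>) \<le> 1"
    using expo \<alpha> by (intro powr_le1) auto
  then have "lower_coeff T \<le> 1 / (8 * (\<Lambda> + T))"
    unfolding lower_coeff_def using T \<Lambda> by (intro divide_right_mono) auto
  also have "\<dots> \<le> 1 / \<Lambda>" using T \<Lambda> by (intro divide_left_mono) auto
  finally show "lower_coeff T \<le> 1 / \<Lambda>" .
qed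

text \<open>The piece \<open>{t/4..t/2}\<close> of the integral already suffices: on it both the
  kernel and the source are bounded below by the right powers of \<open>t\<close>.\<close>

lemma picard_lower_barrier:
  assumes "continuous_on {0..t} u" "0 \<le> t" "t \<le> T"
    and ge: "\<And>s. 0 \<le> s \<Longrightarrow> s \<le> t \<Longrightarrow> barrier (lower_coeff T) s \<le> u s"
  shows "barrier (lower_coeff T) t \<le> picard u t"
proof -
  define k where "k = lower_coeff T"
  have k: "0 < k" using lower_coeff(1) assms by (simp add: k_def)
  let ?q = "(1 / 16 :: real) powr (expo * \<alpha>)"
  have u0: "0 \<le> u s" if "0 \<le> s" "s \<le> t" for s
    using ge[OF that] barrier_nonneg by (rule order_trans[rotated])
  have int: "(\<lambda>s. kernel t s * u s powr \<alpha>) integrable_on {a..b}" if "0 \<le> a" "b \<le> t" for a b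
  proof (intro integrable_continuous_interval kernel_source_continuous)
    show "continuous_on {a..b} u"
      by (rule continuous_on_subset[OF assms(1)]) (use that in auto)
  qed (use that u0 in auto)
  have b4: "barrier k (t / 4) powr \<alpha> = ?q * barrier k t powr \<alpha>"
  proof -
    have "barrier k (t / 4) = (1 / 16) powr expo * barrier k t"
      using k by (simp add: barrier_def powr_mult[symmetric] power_divide)
    then show ?thesis by (simp add: powr_mult powr_powr)
  qed
  have "barrier k t = barrier k t powr \<alpha> * (k * t\<^sup>2)"
    using k by (simp only: barrier_def) (rule powr_expo[symmetric], simp)
  also have "\<dots> = (t / 2 - t / 4) * (t / (2 * (\<Lambda> + T)) * barrier k (t / 4) powr \<alpha>)"
  proof -
    have "k * t\<^sup>2 = (t / 2 - t / 4) * (t / (2 * (\<Lambda> + T))) * ?q"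
      using \<Lambda> assms by (simp add: k_def lower_coeff_def power2_eq_square)
    then show ?thesis unfolding b4 by (simp add: mult_ac)
  qed
  also have "\<dots> = integral {t/4..t/2} (\<lambda>s. t / (2 * (\<Lambda> + T)) * barrier k (t / 4) powr \<alpha>)"
    using assms by simp
  also have "\<dots> \<le> integral {t/4..t/2} (\<lambda>s. kernel t s * u s powr \<alpha>)"
  proof (rule integral_le)
    show "(\<lambda>s. kernel t s * u s powr \<alpha>) integrable_on {t/4..t/2}"
      using assms(2) by (auto intro: int)
    fix s assume s: "s \<in> {t/4..t/2}"
    show "t / (2 * (\<Lambda> + T)) * barrier k (t / 4) powr \<alpha> \<le> kernel t s * u s powr \<alpha>"
    proof (rule mult_mono)
      show "t / (2 * (\<Lambda> + T)) \<le> kernel t s"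
        using s assms by (intro kernel_lower) auto
      have "barrier k (t / 4) \<le> barrier k s"
        using s k assms by (intro barrier_mono) auto
      also have "\<dots> \<le> u s" using ge[of s] s assms by (simp add: k_def)
      finally show "barrier k (t / 4) powr \<alpha> \<le> u s powr \<alpha>"
        using \<alpha> by (intro powr_mono2 barrier_nonneg) auto
      show "0 \<le> kernel t s" using s assms by (intro kernel_nonneg) auto
    qed auto
  qed auto
  also have "\<dots> \<le> picard u t"
    unfolding picard_def
  proof (rule integral_subset_le)
    show "(\<lambda>s. kernel t s * u s powr \<alpha>) integrable_on {t/4..t/2}"
      "(\<lambda>s. kernel t s * u s powr \<alpha>) integrable_on {0..t}"
      using assms(2) by (auto intro: int)
  qed (use assms in \<open>auto intro!: mult_nonneg_nonneg kernel_nonneg\<close>)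
  finally show ?thesis by (simp add: k_def)
qed

section \<open>Monotone iteration from the upper barrier\<close>

primrec iterate :: "nat \<Rightarrow> real \<Rightarrow> real" where
  "iterate 0 = barrier (1 / \<Lambda>)"
| "iterate (Suc n) = picard (iterate n)"

lemma iterate_nonneg: "0 \<le> iterate n t"
  by (cases n) (auto simp: barrier_nonneg picard_nonneg)

lemma iterate_continuous: "continuous_on {0..} (iterate n)"
  using \<Lambda> by (induction n) (auto intro!: barrier_continuous picard_continuous iterate_nonneg)

lemma iterate_continuous_Icc: "0 \<le> a \<Longrightarrow> continuous_on {a..b} (iterate n)"
  by (rule continuous_on_subset[OF iterate_continuous]) auto

lemma iterate_decreasing: "0 \<le> t \<Longrightarrow> iterate (Suc n) t \<le> iterate n t"
proof (induction n arbitrary: t)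
  case 0
  then show ?case using picard_upper_barrier by simp
next
  case (Suc n)
  have "picard (iterate (Suc n)) t \<le> picard (iterate n) t"
    using Suc by (intro picard_mono iterate_continuous_Icc iterate_nonneg) auto
  then show ?case by simp
qed

text \<open>Keeps the decreasing iterates away from the zero function, which is also a fixed point
  of \<open>picard\<close>.\<close>

lemma iterate_lower: "0 \<le> t \<Longrightarrow> t \<le> T \<Longrightarrow> barrier (lower_coeff T) t \<le> iterate n t"
proof (induction n arbitrary: t)
  case 0
  then show ?case using lower_coeff[of T] by (auto intro!: barrier_mono)
next
  case (Suc n)
  then show ?case by (auto intro!: picard_lower_barrier iterate_continuous_Icc)
qed

definition limit :: "real \<Rightarrow> real" where
  "limit t = lim (\<lambda>n. iterate n t)"

lemma iterate_tendsto:
  assumes "0 \<le> t"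
  shows "(\<lambda>n. iterate n t) \<longlonglongrightarrow> limit t"
proof -
  have "decseq (\<lambda>n. iterate n t)"
    using iterate_decreasing[OF assms] by (rule decseq_SucI)
  then have "convergent (\<lambda>n. iterate n t)"
    by (metis decseq_convergent iterate_nonneg convergentI)
  then show ?thesis by (simp add: limit_def convergent_LIMSEQ_iff)
qed

lemma limit_lower: "0 \<le> t \<Longrightarrow> t \<le> T \<Longrightarrow> barrier (lower_coeff T) t \<le> limit t"
  by (rule LIMSEQ_le_const[OF iterate_tendsto]) (auto intro: iterate_lower)

lemma limit_nonneg: "0 \<le> t \<Longrightarrow> 0 \<le> limit t"
  using limit_lower[of t t] barrier_nonneg[of "lower_coeff t" t] by simp

lemma iterate_upper: "0 \<le> t \<Longrightarrow> iterate n t \<le> barrier (1 / \<Lambda>) t"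
  using iterate_decreasing by (induction n) (auto intro: order_trans)

text \<open>Dominated convergence with the upper barrier as majorant. The weight \<open>g\<close>
  stands for the kernel and for the two weights in \<open>picard_split\<close>.\<close>

lemma iterate_dominated:
  assumes g: "continuous_on {0..t} g" "\<And>s. s \<in> {0..t} \<Longrightarrow> 0 \<le> g s"
  shows "(\<lambda>s. g s * limit s powr \<alpha>) integrable_on {0..t}"
    and "(\<lambda>n. integral {0..t} (\<lambda>s. g s * iterate n s powr \<alpha>))
      \<longlonglongrightarrow> integral {0..t} (\<lambda>s. g s * limit s powr \<alpha>)"
proof -
  have i: "(\<lambda>s. g s * iterate n s powr \<alpha>) integrable_on {0..t}" for n
    using g by (auto intro!: integrable_continuous_interval continuous_intros source_continuous
        iterate_continuous_Icc iterate_nonneg)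
  have h: "(\<lambda>s. g s * barrier (1 / \<Lambda>) s powr \<alpha>) integrable_on {0..t}"
    using i[of 0] by simp
  have b: "norm (g s * iterate n s powr \<alpha>) \<le> g s * barrier (1 / \<Lambda>) s powr \<alpha>"
    if "s \<in> {0..t}" for n s
    using that g(2)[OF that] \<alpha> iterate_upper[of s n] iterate_nonneg[of n s]
    by (auto simp: abs_mult intro!: mult_left_mono powr_mono2)
  have l: "(\<lambda>n. g s * iterate n s powr \<alpha>) \<longlonglongrightarrow> g s * limit s powr \<alpha>" if "s \<in> {0..t}" for s
    using that \<alpha> by (intro tendsto_intros tendsto_powr' iterate_tendsto) (auto simp: iterate_nonneg)
  show "(\<lambda>s. g s * limit s powr \<alpha>) integrable_on {0..t}"
    and "(\<lambda>n. integral {0..t} (\<lambda>s. g s * iterate n s powr \<alpha>))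
      \<longlonglongrightarrow> integral {0..t} (\<lambda>s. g s * limit s powr \<alpha>)"
    using dominated_convergence[OF i h b l] by blast+
qed

lemma limit_fixed:
  assumes "0 \<le> t"
  shows "limit t = picard limit t"
proof (rule LIMSEQ_unique)
  show "(\<lambda>n. iterate (Suc n) t) \<longlonglongrightarrow> limit t"
    using iterate_tendsto[OF assms] by (rule LIMSEQ_Suc)
  have "continuous_on {0..t} (kernel t)"
    using \<Lambda> unfolding kernel_def by (auto intro!: continuous_intros)
  from iterate_dominated(2)[OF this] show "(\<lambda>n. iterate (Suc n) t) \<longlonglongrightarrow> picard limit t"
    by (simp add: picard_def kernel_nonneg)
qed

lemma limit_source_integrable:
  "(\<lambda>s. limit s powr \<alpha>) integrable_on {0..t}"
  "(\<lambda>s. exp (s / \<Lambda>) * limit s powr \<alpha>) integrable_on {0..t}"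
  using iterate_dominated(1)[of t "\<lambda>_. 1"] iterate_dominated(1)[of t "\<lambda>s. exp (s / \<Lambda>)"] \<Lambda>
  by (simp_all add: continuous_intros)

text \<open>A pointwise limit may lose continuity; the fixed point equation restores it, as
  \<open>picard_continuous_Icc\<close> asks for integrability alone.\<close>

lemma limit_continuous: "continuous_on {0..} limit"
proof (rule continuous_on_atLeast_of_Icc)
  show "continuous_on {0..T} limit" for T
    using picard_continuous_Icc[OF limit_source_integrable] limit_fixed
    by (subst continuous_on_cong[OF refl]) auto
qed

lemma profile_exists:
  obtains U F :: "real \<Rightarrow> real" where
    "\<And>t. (U has_real_derivative (F t - U t) / \<Lambda>) (at t)"
    "\<And>t. (F has_real_derivative U t powr \<alpha>) (at t)"
    "U 0 = 0" "F 0 = 0"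
    "\<And>t. 0 < t \<Longrightarrow> 0 < U t"
    "\<And>T. 0 \<le> T \<Longrightarrow> \<exists>k>0. \<forall>t\<in>{0..T}. barrier k t \<le> U t"
proof -
  \<comment> \<open>Since \<open>limit 0 = 0\<close>, this is the extension by zero, which makes the
    derivatives at 0 two-sided.\<close>
  define U where "U t = limit (max 0 t)" for t
  have U: "U t = limit t" if "0 \<le> t" for t using that by (simp add: U_def)
  have lim0: "limit 0 = 0" using limit_fixed[of 0] by (simp add: picard_def)
  have Uneg: "U t = 0" if "t \<le> 0" for t using that lim0 by (simp add: U_def)
  have "continuous_on UNIV U" unfolding U_def
    by (rule continuous_on_compose2[OF limit_continuous]) (auto intro!: continuous_intros)
  then have c: "continuous_on UNIV (\<lambda>s. U s powr \<alpha>)"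
    by (rule source_continuous) (simp add: U_def limit_nonneg)
  then have ce: "continuous_on UNIV (\<lambda>s. exp (s / \<Lambda>) * U s powr \<alpha>)"
    using \<Lambda> by (auto intro!: continuous_intros)
  obtain F where F: "F 0 = 0" "\<And>t. (F has_real_derivative U t powr \<alpha>) (at t)"
    "\<And>t. 0 \<le> t \<Longrightarrow> integral {0..t} (\<lambda>s. U s powr \<alpha>) = F t"
    using antiderivative_UNIV[OF c] by blast
  obtain E where E: "E 0 = 0" "\<And>t. (E has_real_derivative exp (t / \<Lambda>) * U t powr \<alpha>) (at t)"
    "\<And>t. 0 \<le> t \<Longrightarrow> integral {0..t} (\<lambda>s. exp (s / \<Lambda>) * U s powr \<alpha>) = E t"
    using antiderivative_UNIV[OF ce] by blast
  \<comment> \<open>The split form of the fixed point equation: on differentiating it the source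
    terms cancel, leaving \<open>exp (- t / \<Lambda>) * E t / \<Lambda>\<close>, which is
    \<open>(F t - U t) / \<Lambda>\<close>.\<close>
  have Ueq: "U t = F t - exp (- t / \<Lambda>) * E t" for t
  proof (cases "0 \<le> t")
    case True
    have "integral {0..t} (\<lambda>s. limit s powr \<alpha>) = integral {0..t} (\<lambda>s. U s powr \<alpha>)"
      "integral {0..t} (\<lambda>s. exp (s / \<Lambda>) * limit s powr \<alpha>)
        = integral {0..t} (\<lambda>s. exp (s / \<Lambda>) * U s powr \<alpha>)"
      by (auto intro!: integral_cong simp: U)
    then show ?thesis
      using picard_split[OF limit_source_integrable, of t] limit_fixed[OF True] F(3) E(3) True
      by (simp add: U)
  next
    case False
    then have "F t = 0" "E t = 0"
      using vanishes_on_negatives[OF F(1,2)] vanishes_on_negatives[OF E(1,2)] Uneg \<alpha> by auto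
    then show ?thesis using Uneg False by simp
  qed
  show thesis
  proof
    fix t
    have "((\<lambda>t. F t - exp (- t / \<Lambda>) * E t) has_real_derivative
        exp (- t / \<Lambda>) * E t / \<Lambda>) (at t)"
      using \<Lambda> by (auto intro!: derivative_eq_intros F(2) E(2) simp: mult_exp_exp)
    then show "(U has_real_derivative (F t - U t) / \<Lambda>) (at t)"
      using Ueq by (simp add: Ueq[abs_def])
    show "(F has_real_derivative U t powr \<alpha>) (at t)" by (rule F)
    show "U 0 = 0" "F 0 = 0" using Uneg F by auto
    show "0 < U t" if "0 < t"
    proof -
      have "0 < barrier (lower_coeff t) t"
        using that lower_coeff(1)[of t] by (simp add: barrier_def)
      then show ?thesis using limit_lower[of t t] that by (simp add: U)
    qed
  next
    fix T :: real assume "0 \<le> T"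
    then show "\<exists>k>0. \<forall>t\<in>{0..T}. barrier k t \<le> U t"
      using lower_coeff(1)[of T] limit_lower[of _ T] U by (intro exI[of _ "lower_coeff T"]) auto
  qed
qed

end

section \<open>Monotonicity and the balance equation\<close>

text \<open>Hides the construction of the profile. The last assumption keeps the quantitative rate
  at which \<open>U\<close> leaves zero.\<close>

locale combustion_profile = combustion +
  fixes U F :: "real \<Rightarrow> real"
  assumes U_deriv: "\<And>t. (U has_real_derivative (F t - U t) / \<Lambda>) (at t)"
    and F_deriv: "\<And>t. (F has_real_derivative U t powr \<alpha>) (at t)"
    and U_0: "U 0 = 0" and F_0: "F 0 = 0"
    and U_pos: "\<And>t. 0 < t \<Longrightarrow> 0 < U t"
    and U_lower: "\<And>T. 0 \<le> T \<Longrightarrow> \<exists>k>0. \<forall>t\<in>{0..T}. barrier k t \<le> U t"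
begin

definition U1 :: "real \<Rightarrow> real" where
  "U1 t = (F t - U t) / \<Lambda>"

lemma U_has_deriv: "(U has_real_derivative U1 t) (at t)"
  using U_deriv by (simp add: U1_def)

lemma F_eq: "F t = \<Lambda> * U1 t + U t"
  using \<Lambda> by (simp add: U1_def)

lemma U1_deriv: "(U1 has_real_derivative (U t powr \<alpha> - U1 t) / \<Lambda>) (at t)"
  unfolding U1_def [abs_def] using \<Lambda>
  by (auto intro!: derivative_eq_intros U_deriv F_deriv)

lemma U1_0: "U1 0 = 0"
  by (simp add: U1_def U_0 F_0)

lemma U_continuous: "continuous_on S U" and F_continuous: "continuous_on S F"
  and U1_continuous: "continuous_on S U1"
  by (rule DERIV_continuous_on, rule DERIV_subset[OF _ subset_UNIV],
      rule U_deriv F_deriv U1_deriv)+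

lemma U_nonneg: "0 \<le> t \<Longrightarrow> 0 \<le> U t"
  using U_pos[of t] U_0 by (cases "t = 0") auto

lemma profile_on_U: "profile_on T U F"
  by (simp add: profile_on_def U_continuous F_continuous U_deriv F_deriv U_nonneg)

text \<open>The slope relaxes towards the positive source \<open>U powr \<alpha>\<close>.\<close>

lemma U1_pos:
  assumes "0 < t"
  shows "0 < U1 t"
proof (rule pos_of_relaxation[where T = t and \<Lambda> = \<Lambda> and x = U1 and r = "\<lambda>t. U t powr \<alpha>"])
  show "0 < U s powr \<alpha>" if "0 < s" for s
    using U_pos[OF that] by simp
qed (simp_all add: assms \<Lambda> U1_continuous U1_0 U1_deriv)

lemma U1_nonneg: "0 \<le> t \<Longrightarrow> 0 \<le> U1 t"
  using U1_pos[of t] U1_0 by (cases "t = 0") auto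

lemma F_pos: "0 < t \<Longrightarrow> 0 < F t"
  using U_pos[of t] U1_pos[of t] \<Lambda> by (simp add: F_eq add_pos_pos)

lemma source_deriv:
  assumes "0 < t"
  shows "((\<lambda>t. U t powr \<alpha>) has_real_derivative \<alpha> * U t powr (\<alpha> - 1) * U1 t) (at t)"
  using U_pos[OF assms] by (auto intro!: derivative_eq_intros U_has_deriv)

text \<open>Convexity of \<open>U\<close>: the difference is \<open>\<Lambda> * U''\<close>, and it
  satisfies a relaxation equation whose source comes from the derivative of
  \<open>U powr \<alpha>\<close>.\<close>

lemma U1_le_source:
  assumes "0 \<le> t"
  shows "U1 t \<le> U t powr \<alpha>"
proof -
  have "0 \<le> U t powr \<alpha> - U1 t"
  proof (rule nonneg_of_relaxation[where T = t and \<Lambda> = \<Lambda> and x = "\<lambda>t. U t powr \<alpha> - U1 t"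
        and r = "\<lambda>t. \<Lambda> * (\<alpha> * U t powr (\<alpha> - 1) * U1 t)"])
    show "continuous_on {0..t} (\<lambda>t. U t powr \<alpha> - U1 t)"
      by (intro continuous_intros source_continuous U_continuous U1_continuous) (simp add: U_nonneg)
    show "((\<lambda>t. U t powr \<alpha> - U1 t) has_real_derivative
        (\<Lambda> * (\<alpha> * U t powr (\<alpha> - 1) * U1 t) - (U t powr \<alpha> - U1 t)) / \<Lambda>) (at t)" if "0 < t" for t
      using DERIV_diff[OF source_deriv[OF that] U1_deriv[of t]] \<Lambda> by (simp add: diff_divide_distrib)
  qed (use \<Lambda> \<alpha> assms in \<open>simp_all add: U_0 U1_0 U1_nonneg\<close>)
  then show ?thesis by simp
qed

lemma U1_mono:
  assumes "0 \<le> s" "s \<le> t"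
  shows "U1 s \<le> U1 t"
proof (rule nondecreasing_of_deriv_nonneg[where a = 0 and b = t and f = U1
      and f' = "\<lambda>t. (U t powr \<alpha> - U1 t) / \<Lambda>"])
  show "0 \<le> (U t powr \<alpha> - U1 t) / \<Lambda>" if "0 < t" for t
    using U1_le_source[of t] \<Lambda> that by simp
qed (simp_all add: assms U1_continuous U1_deriv)

text \<open>By convexity the tangent at \<open>t\<close> lies below \<open>U 0 = 0\<close> at time
  0.\<close>

lemma U_le_mult_U1:
  assumes "0 \<le> t"
  shows "U t \<le> t * U1 t"
proof -
  have "0 * U1 0 - U 0 \<le> t * U1 t - U t"
  proof (rule nondecreasing_of_deriv_nonneg[where a = 0 and b = t and f = "\<lambda>t. t * U1 t - U t"
        and f' = "\<lambda>t. t * ((U t powr \<alpha> - U1 t) / \<Lambda>)"])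
    show "continuous_on {0..t} (\<lambda>t. t * U1 t - U t)"
      by (intro continuous_intros U_continuous U1_continuous)
    show "((\<lambda>t. t * U1 t - U t) has_real_derivative t * ((U t powr \<alpha> - U1 t) / \<Lambda>)) (at t)" for t
      using DERIV_diff[OF DERIV_mult[OF DERIV_ident U1_deriv[of t]] U_has_deriv[of t]]
      by (simp add: mult.commute)
    show "0 \<le> t * ((U t powr \<alpha> - U1 t) / \<Lambda>)" if "0 < t" for t
      using U1_le_source[of t] \<Lambda> that by simp
  qed (use assms in auto)
  then show ?thesis by (simp add: U_0)
qed

text \<open>By convexity \<open>U\<close> lies above its tangent at 1; the positive value
  \<open>U 1\<close> is dropped. In particular \<open>U\<close> is unbounded.\<close>

lemma U_ge_linear:
  assumes "1 \<le> t"
  shows "U1 1 * (t - 1) \<le> U t"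
proof -
  have "U 1 - U1 1 * 1 \<le> U t - U1 1 * t"
  proof (rule nondecreasing_of_deriv_nonneg[where a = 1 and b = t and f = "\<lambda>t. U t - U1 1 * t"
        and f' = "\<lambda>t. U1 t - U1 1"])
    show "continuous_on {1..t} (\<lambda>t. U t - U1 1 * t)"
      by (intro continuous_intros U_continuous)
    show "((\<lambda>t. U t - U1 1 * t) has_real_derivative U1 t - U1 1) (at t)" for t
      using DERIV_diff[OF U_has_deriv[of t] DERIV_cmult_Id[of "U1 1"]] by simp
    show "0 \<le> U1 t - U1 1" if "1 < t" for t
      using U1_mono[of 1 t] that by simp
  qed (use assms in auto)
  then show ?thesis using U_pos[of 1] by (simp add: algebra_simps)
qed

text \<open>Strict monotonicity of \<open>U / F\<close> rests on the identity
  \<open>\<Lambda> * N' + N = (1 - \<alpha>) * \<Lambda> * U powr \<alpha> * U1\<close> for the Wronskian-like \<open>N = U1 * F - U * U powr \<alpha>\<close>.\<close>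

lemma wronskian_pos:
  assumes "0 < t"
  shows "0 < U1 t * F t - U t * U t powr \<alpha>"
proof (rule pos_of_relaxation[where T = t and \<Lambda> = \<Lambda>
      and x = "\<lambda>t. U1 t * F t - U t * U t powr \<alpha>"
      and r = "\<lambda>t. (1 - \<alpha>) * \<Lambda> * U t powr \<alpha> * U1 t"])
  show "continuous_on {0..t} (\<lambda>t. U1 t * F t - U t * U t powr \<alpha>)"
    by (intro continuous_intros source_continuous U_continuous U1_continuous F_continuous)
      (simp add: U_nonneg)
  fix t :: real assume t: "0 < t"
  have e: "\<alpha> * U t powr (\<alpha> - 1) * U1 t * U t = \<alpha> * U t powr \<alpha> * U1 t"
    using U_pos[OF t] by (simp add: powr_diff)
  have "((\<lambda>t. U1 t * F t - U t * U t powr \<alpha>) has_real_derivative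
      (U t powr \<alpha> - U1 t) / \<Lambda> * F t + U t powr \<alpha> * U1 t
        - (U1 t * U t powr \<alpha> + \<alpha> * U t powr \<alpha> * U1 t)) (at t)"
    using DERIV_diff[OF DERIV_mult[OF U1_deriv F_deriv] DERIV_mult[OF U_has_deriv source_deriv[OF t]]]
    by (simp only: e)
  moreover have "(U t powr \<alpha> - U1 t) / \<Lambda> * F t + U t powr \<alpha> * U1 t
        - (U1 t * U t powr \<alpha> + \<alpha> * U t powr \<alpha> * U1 t)
      = ((1 - \<alpha>) * \<Lambda> * U t powr \<alpha> * U1 t - (U1 t * F t - U t * U t powr \<alpha>)) / \<Lambda>"
    using \<Lambda> by (simp add: F_eq field_simps)
  ultimately show "((\<lambda>t. U1 t * F t - U t * U t powr \<alpha>) has_real_derivative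
      ((1 - \<alpha>) * \<Lambda> * U t powr \<alpha> * U1 t - (U1 t * F t - U t * U t powr \<alpha>)) / \<Lambda>) (at t)"
    by simp
next
  show "0 < (1 - \<alpha>) * \<Lambda> * U t powr \<alpha> * U1 t" if "0 < t" for t
    using U_pos[OF that] U1_pos[OF that] \<alpha> \<Lambda> by simp
qed (use assms \<Lambda> in \<open>simp_all add: U_0 U1_0\<close>)

text \<open>The derivative of the ratio is the expression in \<open>wronskian_pos\<close> over
  \<open>F * F\<close>. Injectivity lets \<open>v0\<close> determine \<open>c * R\<close>.\<close>

lemma ratio_strict_mono:
  assumes "0 < s" "s < t"
  shows "U s / F s < U t / F t"
proof (rule increasing_of_deriv_pos[where a = s and b = t and f = "\<lambda>t. U t / F t"
      and f' = "\<lambda>t. (U1 t * F t - U t * U t powr \<alpha>) / (F t * F t)"])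
  have F: "F x \<noteq> 0" if "s \<le> x" for x using F_pos[of x] that assms by simp
  show "continuous_on {s..t} (\<lambda>t. U t / F t)"
    by (intro continuous_intros U_continuous F_continuous) (use F in auto)
  show "((\<lambda>t. U t / F t) has_real_derivative (U1 x * F x - U x * U x powr \<alpha>) / (F x * F x)) (at x)"
    if "s < x" for x
    using DERIV_divide[OF U_has_deriv F_deriv F[of x]] that by simp
  show "0 < (U1 x * F x - U x * U x powr \<alpha>) / (F x * F x)" if "s < x" for x
    using wronskian_pos[of x] F_pos[of x] that assms by simp
qed (use assms in auto)

text \<open>\<open>U1 / U\<close> is at most \<open>U powr (\<alpha> - 1)\<close>, which tends to 0
  because \<open>U\<close> is unbounded.\<close>

lemma exists_ratio_small:
  assumes "0 < \<epsilon>"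
  shows "\<exists>t\<ge>1. U1 t \<le> \<epsilon> * U t"
proof -
  define M where "M = \<epsilon> powr (- expo)"
  have M: "0 < M" using assms by (simp add: M_def)
  have Me: "M powr (\<alpha> - 1) = \<epsilon>"
  proof -
    have "- expo * (\<alpha> - 1) = 1" using \<alpha> by (simp add: expo_def field_simps)
    then show ?thesis using assms unfolding M_def powr_powr by simp
  qed
  \<comment> \<open>The time at which the linear lower bound of \<open>U_ge_linear\<close> reaches
    \<open>M\<close>.\<close>
  define t where "t = 1 + M / U1 1"
  have t: "1 \<le> t" using M U1_pos[of 1] by (simp add: t_def)
  have "M \<le> U t"
    using U_ge_linear[OF t] U1_pos[of 1] by (simp add: t_def)
  have "U1 t \<le> U t powr \<alpha>" using U1_le_source t by simp
  also have "\<dots> = U t powr (\<alpha> - 1) * U t"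
    using M \<open>M \<le> U t\<close> by (simp add: powr_diff)
  also have "\<dots> \<le> M powr (\<alpha> - 1) * U t"
    using M \<open>M \<le> U t\<close> \<alpha> by (intro mult_right_mono powr_mono2') auto
  finally show ?thesis using t Me by auto
qed

text \<open>After time reversal and rescaling, \<open>exp (- \<rho>) * W \<rho>\<close> is the
  integral in \<Phi> up to the factor \<open>amp c\<close>.\<close>

definition W :: "real \<Rightarrow> real" where
  "W = (SOME W. W 0 = 0 \<and> (\<forall>t. (W has_real_derivative exp t * U1 t) (at t)))"

lemma W_0: "W 0 = 0" and W_deriv: "(W has_real_derivative exp t * U1 t) (at t)"
proof -
  have "continuous_on UNIV (\<lambda>t. exp t * U1 t)"
    by (intro continuous_intros U1_continuous)
  then obtain G where "G 0 = 0" "\<And>t. (G has_real_derivative exp t * U1 t) (at t)"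
    using antiderivative_UNIV by blast
  then have "\<exists>W. W 0 = 0 \<and> (\<forall>t. (W has_real_derivative exp t * U1 t) (at t))"
    by blast
  then have "W 0 = 0 \<and> (\<forall>t. (W has_real_derivative exp t * U1 t) (at t))"
    unfolding W_def by (rule someI_ex)
  then show "W 0 = 0" "(W has_real_derivative exp t * U1 t) (at t)" by auto
qed

lemma W_continuous: "continuous_on S W"
  by (rule DERIV_continuous_on, rule DERIV_subset[OF _ subset_UNIV], rule W_deriv)

lemma W_nonneg:
  assumes "0 \<le> t"
  shows "0 \<le> W t"
proof -
  have "W 0 \<le> W t"
    by (rule nondecreasing_of_deriv_nonneg[where a = 0 and b = t and f = W
          and f' = "\<lambda>t. exp t * U1 t"])
      (simp_all add: assms W_continuous W_deriv U1_nonneg)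
  then show ?thesis by (simp add: W_0)
qed

text \<open>As \<open>U1\<close> is nondecreasing, \<open>exp t * U1 t - W t\<close> has the
  nonnegative derivative \<open>exp t * U1' t\<close> and starts at 0.\<close>

lemma W_upper:
  assumes "0 \<le> t"
  shows "exp (- t) * W t \<le> U1 t"
proof -
  have "exp 0 * U1 0 - W 0 \<le> exp t * U1 t - W t"
  proof (rule nondecreasing_of_deriv_nonneg[where a = 0 and b = t
        and f = "\<lambda>t. exp t * U1 t - W t"
        and f' = "\<lambda>t. exp t * ((U t powr \<alpha> - U1 t) / \<Lambda>)"])
    show "0 \<le> exp t * ((U t powr \<alpha> - U1 t) / \<Lambda>)" if "0 < t" for t
      using \<Lambda> U1_le_source[of t] that by simp
    show "((\<lambda>t. exp t * U1 t - W t) has_real_derivative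
        exp t * ((U t powr \<alpha> - U1 t) / \<Lambda>)) (at t)" for t
      using DERIV_diff[OF DERIV_mult[OF DERIV_exp U1_deriv[of t]] W_deriv[of t]]
      by (simp add: mult.commute)
    show "continuous_on {0..t} (\<lambda>t. exp t * U1 t - W t)"
      by (intro continuous_intros W_continuous U1_continuous)
  qed (use assms in auto)
  then have "exp (- t) * W t \<le> exp (- t) * (exp t * U1 t)"
    by (intro mult_left_mono) (auto simp: W_0 U1_0)
  then show ?thesis by (simp add: mult.assoc[symmetric] exp_minus)
qed

text \<open>This is the unprojected fixed point equation at \<open>v0 = U \<rho> / F \<rho>\<close>
  and amplitude \<open>1 / F \<rho>\<close>, multiplied by \<open>F \<rho>\<close>.\<close>

lemma exists_balance:
  assumes "0 < \<theta>" "\<theta> < 1"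
  shows "\<exists>\<rho>>0. U \<rho> - (1 - \<Lambda>) * (exp (- \<rho>) * W \<rho>) = (1 - \<theta>) * F \<rho>"
proof -
  define H where "H t = U t - (1 - \<Lambda>) * (exp (- t) * W t) - (1 - \<theta>) * F t" for t
  \<comment> \<open>Chosen so that \<open>U a \<le> a * U1 a\<close> is already at most
    \<open>(1 - \<theta>) * F a\<close>.\<close>
  define a where "a = \<Lambda> * (1 - \<theta>)"
  have a: "0 < a" "a \<le> 1" using assms \<Lambda> by (auto simp: a_def mult_le_one)
  \<comment> \<open>Half of \<theta>, because two terms of size at most \<open>U1 b\<close> have to
    be absorbed by \<open>\<theta> * U b\<close>.\<close>
  obtain b where b: "1 \<le> b" "U1 b \<le> \<theta> / 2 * U b"
    using exists_ratio_small[of "\<theta> / 2"] assms by auto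
  have "H a \<le> 0"
  proof -
    have "U a \<le> a * U1 a" using U_le_mult_U1 a by simp
    also have "\<dots> = (1 - \<theta>) * (\<Lambda> * U1 a)" by (simp add: a_def)
    also have "\<dots> \<le> (1 - \<theta>) * F a"
      using assms U_pos[of a] a by (intro mult_left_mono) (auto simp: F_eq)
    finally have "U a \<le> (1 - \<theta>) * F a" .
    moreover have "0 \<le> (1 - \<Lambda>) * (exp (- a) * W a)" using W_nonneg[of a] a \<Lambda> by simp
    ultimately show ?thesis by (simp add: H_def)
  qed
  moreover have "0 \<le> H b"
  proof -
    have U1b: "0 \<le> U1 b" using U1_nonneg b by simp
    have "(1 - \<Lambda>) * (exp (- b) * W b) \<le> 1 * U1 b"
      using W_upper[of b] W_nonneg[of b] b \<Lambda> by (intro mult_mono) auto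
    moreover have "(1 - \<theta>) * F b \<le> (1 - \<theta>) * U b + U1 b"
    proof -
      have "(1 - \<theta>) * \<Lambda> * U1 b \<le> 1 * U1 b"
        using assms \<Lambda> U1b by (intro mult_right_mono mult_le_one) auto
      then show ?thesis by (simp add: F_eq algebra_simps)
    qed
    ultimately show ?thesis using b(2) by (simp add: H_def algebra_simps)
  qed
  moreover have "continuous_on {a..b} H" unfolding H_def
    by (intro continuous_intros U_continuous F_continuous W_continuous)
  ultimately have "\<exists>\<rho>\<ge>a. \<rho> \<le> b \<and> H \<rho> = 0"
    using a b by (intro IVT') simp_all
  then obtain \<rho> where "a \<le> \<rho>" "H \<rho> = 0" by blast
  then have "0 < \<rho>" "U \<rho> - (1 - \<Lambda>) * (exp (- \<rho>) * W \<rho>) = (1 - \<theta>) * F \<rho>"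
    using a by (simp_all add: H_def)
  then show ?thesis by blast
qed

end

section \<open>Smoothness and the support of solutions\<close>

context combustion begin

definition amp :: "real \<Rightarrow> real" where
  "amp c = c powr (- 2 * expo)"

lemma amp_pos: "0 < c \<Longrightarrow> 0 < amp c"
  by (simp add: amp_def)

text \<open>The scaling law behind \<open>amp\<close>: the amplitude raised to \<alpha> matches the
  factor \<open>c\<^sup>2\<close> produced by two derivatives.\<close>

lemma amp_powr:
  assumes "0 < c"
  shows "amp c powr \<alpha> = c\<^sup>2 * amp c"
proof -
  have "- 2 * expo * \<alpha> = 2 + - 2 * expo" using expo(2) by (simp add: algebra_simps)
  then have "amp c powr \<alpha> = c powr (2 + - 2 * expo)"
    unfolding amp_def powr_powr by (rule arg_cong)
  also have "\<dots> = c\<^sup>2 * amp c"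
    using assms unfolding powr_add amp_def by simp
  finally show ?thesis .
qed

lemma amp_inverse: "0 < c \<Longrightarrow> amp c powr (- 1 / (2 * expo)) = c"
  using expo(1) by (simp add: amp_def powr_powr)

lemma amp_surj: "0 < a \<Longrightarrow> amp (a powr (- 1 / (2 * expo))) = a"
  using expo(1) by (simp add: amp_def powr_powr)

lemma amp_inj: "0 < c \<Longrightarrow> 0 < d \<Longrightarrow> amp c = amp d \<Longrightarrow> c = d"
  using amp_inverse by metis

end

context combustion_profile begin

text \<open>A class containing \<open>U1\<close> and closed under differentiation along the
  equation. Real exponents \<open>b\<close> are needed, since each derivative lowers the power of
  \<open>U\<close>; this is harmless where \<open>U > 0\<close>.\<close>

inductive ode_term :: "(real \<Rightarrow> real) \<Rightarrow> bool" where
  monomial: "ode_term (\<lambda>t. a * U t powr b * U1 t ^ n)"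
| plus: "ode_term f \<Longrightarrow> ode_term g \<Longrightarrow> ode_term (\<lambda>t. f t + g t)"

lemma ode_term_deriv:
  assumes "ode_term f"
  shows "\<exists>g. ode_term g \<and> (\<forall>t>0. (f has_real_derivative g t) (at t))"
  using assms
proof induction
  case (monomial a b n)
  \<comment> \<open>For \<open>n = 0\<close> the truncated exponent \<open>n - 1\<close> does no
    harm: its coefficient contains the factor \<open>n\<close>.\<close>
  define g where "g t = a * b * U t powr (b - 1) * U1 t ^ Suc n +
    (a * n / \<Lambda> * U t powr (b + \<alpha>) * U1 t ^ (n - 1) + - (a * n / \<Lambda>) * U t powr b * U1 t ^ n)" for t
  have "ode_term g"
    unfolding g_def by (intro ode_term.intros)
  moreover have "((\<lambda>t. a * U t powr b * U1 t ^ n) has_real_derivative g t) (at t)" if t: "0 < t" for t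
  proof -
    have p: "((\<lambda>t. U t powr b) has_real_derivative b * U t powr (b - 1) * U1 t) (at t)"
      using U_pos[OF t] by (auto intro!: derivative_eq_intros U_has_deriv)
    have "((\<lambda>t. a * U t powr b * U1 t ^ n) has_real_derivative
      a * (b * U t powr (b - 1) * U1 t) * U1 t ^ n +
      (real n * ((U t powr \<alpha> - U1 t) / \<Lambda> * U1 t ^ (n - 1))) * (a * U t powr b)) (at t)"
      using DERIV_mult[OF DERIV_cmult[OF p, of a] DERIV_power[OF U1_deriv[of t], of n]]
      by simp
    moreover have "a * (b * U t powr (b - 1) * U1 t) * U1 t ^ n +
      (real n * ((U t powr \<alpha> - U1 t) / \<Lambda> * U1 t ^ (n - 1))) * (a * U t powr b) = g t"
      using \<Lambda> by (cases n) (simp_all add: g_def powr_add field_simps)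
    ultimately show ?thesis by simp
  qed
  ultimately show ?case by blast
next
  case (plus f g)
  then obtain f' g' where "ode_term f'" "\<forall>t>0. (f has_real_derivative f' t) (at t)"
    "ode_term g'" "\<forall>t>0. (g has_real_derivative g' t) (at t)"
    by blast
  then show ?case
    by (intro exI[of _ "\<lambda>t. f' t + g' t"]) (auto intro: ode_term.plus DERIV_add)
qed

lemma U_smooth:
  "\<exists>D. D 0 = U \<and> (\<forall>k. \<forall>t>0. (D k has_real_derivative D (Suc k) t) (at t))"
proof -
  \<comment> \<open>The zeroth entry must be \<open>U\<close> itself as a total function; only from
    the first derivative on are terms of the class used.\<close>
  define P where "P n f \<longleftrightarrow> (if n = (0::nat) then f = U else ode_term f)" for n f
  define Q :: "nat \<Rightarrow> (real \<Rightarrow> real) \<Rightarrow> (real \<Rightarrow> real) \<Rightarrow> bool"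
    where "Q n f g \<longleftrightarrow> (\<forall>t>0. (f has_real_derivative g t) (at t))" for n f g
  have "\<exists>D. \<forall>n. P n (D n) \<and> Q n (D n) (D (Suc n))"
  proof (rule dependent_nat_choice)
    show "\<exists>f. P 0 f" by (simp add: P_def)
    fix f n assume f: "P n f"
    show "\<exists>g. P (Suc n) g \<and> Q n f g"
    proof (cases "n = 0")
      case True
      have "ode_term (\<lambda>t. 1 * U t powr 0 * U1 t ^ 1)" by (rule monomial)
      moreover have "(U has_real_derivative 1 * U t powr 0 * U1 t ^ 1) (at t)" if "0 < t" for t
        using U_has_deriv[of t] U_pos[OF that] by simp
      ultimately show ?thesis using f True unfolding P_def Q_def by auto
    next
      case False
      then show ?thesis using f ode_term_deriv[of f] by (simp add: P_def Q_def)
    qed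
  qed
  then show ?thesis unfolding P_def Q_def by metis
qed

text \<open>\<tau> is the last zero of \<open>u\<close>. Monotonicity makes \<open>u\<close> vanish
  up to \<tau>, so \<open>y\<close> is constant there, and uniqueness applies to the positive part
  after \<tau>.\<close>

lemma profile_on_delayed:
  assumes u: "profile_on T u y" and 0: "u 0 = 0" "y 0 = 0" and T: "0 < T" "0 < u T"
  shows "\<exists>\<tau>. 0 \<le> \<tau> \<and> \<tau> < T \<and> (\<forall>t. 0 \<le> t \<longrightarrow> t \<le> \<tau> \<longrightarrow> u t = 0) \<and>
    (\<forall>t. 0 \<le> t \<longrightarrow> t \<le> T - \<tau> \<longrightarrow> u (t + \<tau>) = U t \<and> y (t + \<tau>) = F t)"
proof -
  define Z where "Z = {t \<in> {0..T}. u t = 0}"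
  have "closed Z" unfolding Z_def
    by (rule continuous_closed_preimage_constant[OF profile_onD(1)[OF u]]) simp
  moreover have "bounded Z" by (rule bounded_subset[of "{0..T}"]) (auto simp: Z_def)
  moreover have "0 \<in> Z" using T 0 by (simp add: Z_def)
  ultimately obtain \<tau> where \<tau>: "\<tau> \<in> Z" "\<And>t. t \<in> Z \<Longrightarrow> t \<le> \<tau>"
    using compact_attains_sup[of Z] compact_eq_bounded_closed by blast
  have \<tau>T: "0 \<le> \<tau>" "\<tau> < T" "u \<tau> = 0" using \<tau>(1) T by (auto simp: Z_def order_less_le)
  have zero: "u t = 0" if "0 \<le> t" "t \<le> \<tau>" for t
    using profile_on_mono[OF u _ that] profile_onD(5)[OF u, of t] that 0 \<tau>T by simp
  have y\<tau>: "y \<tau> = 0"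
  proof (cases "\<tau> = 0")
    case False
    have "y \<tau> = y 0"
    proof (rule DERIV_isconst2[of 0 \<tau>])
      show "continuous_on {0..\<tau>} y"
        using profile_onD(2)[OF u] by (rule continuous_on_subset) (use \<tau>T in auto)
      show "(y has_real_derivative 0) (at x)" if "0 < x" "x < \<tau>" for x
        using profile_onD(4)[OF u, of x] zero[of x] that \<tau>T by simp
    qed (use False \<tau>T in auto)
    then show ?thesis using 0 by simp
  qed (use 0 in simp)
  have "u (t + \<tau>) = U t \<and> y (t + \<tau>) = F t" if t: "0 \<le> t" "t \<le> T - \<tau>" for t
  proof -
    have pos: "0 < u (s + \<tau>)" if "0 < s" "s \<le> T - \<tau>" for s
      using \<tau>(2)[of "s + \<tau>"] profile_onD(5)[OF u, of "s + \<tau>"] that \<tau>T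
      by (force simp: Z_def order_less_le)
    have sh: "profile_on (T - \<tau>) (\<lambda>t. u (t + \<tau>)) (\<lambda>t. y (t + \<tau>))"
      using \<tau>T by (intro profile_on_shift[OF u]) auto
    show ?thesis
      using profile_on_unique[OF sh profile_on_U U_0 F_0 _ _ pos U_pos t] \<tau>T y\<tau> by simp
  qed
  with \<tau>T zero show ?thesis by blast
qed

text \<open>Without smoothness a solution could be prolonged by zero; \<open>C\<^sup>\<infinity>\<close> excludes this because
  \<open>U\<close> detaches from zero only like a fixed power of the distance.\<close>

lemma smooth_not_delayed:
  assumes D: "\<And>k x. a < x \<Longrightarrow> x < b \<Longrightarrow> (D k has_real_derivative D (Suc k) x) (at x)"
    and p: "a < p" "p < b" and flat: "\<And>x. p < x \<Longrightarrow> x < b \<Longrightarrow> D 0 x = 0"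
    and A: "0 < A" "0 < c" and e: "0 < e"
    and U: "\<And>h. 0 < h \<Longrightarrow> h < e \<Longrightarrow> D 0 (p - h) = A * U (c * h)"
  shows False
proof -
  \<comment> \<open>Any Taylor order above the growth exponent \<open>2 * expo\<close> of the lower
    barrier yields the contradiction.\<close>
  define n where "n = nat \<lceil>2 * expo\<rceil> + 1"
  have n: "2 * expo < n" unfolding n_def by linarith
  obtain M d where d: "0 < d" "\<And>h. 0 < h \<Longrightarrow> h < d \<Longrightarrow> \<bar>D 0 (p - h)\<bar> \<le> M * h ^ n"
    using smooth_flat_bound[of a p b n D] p D flat by (auto simp: n_def)
  obtain k where k: "0 < k" "\<And>t. 0 \<le> t \<Longrightarrow> t \<le> c * e \<Longrightarrow> barrier k t \<le> U t"
    using U_lower[of "c * e"] A e by fastforce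
  define B where "B = A * (k * c\<^sup>2) powr expo"
  have B: "0 < B" using A k by (simp add: B_def)
  \<comment> \<open>Barrier from below, Taylor from above, both divided by
    \<open>h powr (2 * expo)\<close>; as \<open>h\<close> tends to 0 the right-hand side
    vanishes.\<close>
  have le: "B \<le> M * h powr (n - 2 * expo)" if h: "0 < h" "h < d" "h < e" for h
  proof -
    have "B * h powr (2 * expo) = A * barrier k (c * h)"
    proof -
      have "barrier k (c * h) = (k * c\<^sup>2) powr expo * (h\<^sup>2) powr expo"
        using h A k by (simp add: barrier_def powr_mult[symmetric] power_mult_distrib mult.assoc)
      also have "(h\<^sup>2) powr expo = h powr (2 * expo)"
        using h by (simp add: powr_powr flip: powr_numeral)
      finally show ?thesis by (simp add: B_def)
    qed
    also have "\<dots> \<le> A * U (c * h)"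
      using k(2)[of "c * h"] A h by (intro mult_left_mono) auto
    also have "\<dots> = D 0 (p - h)" using U h by simp
    also have "\<dots> \<le> M * h ^ n" using d(2)[of h] h by linarith
    also have "\<dots> = M * h powr (n - 2 * expo) * h powr (2 * expo)"
      using h by (simp add: powr_add[symmetric] powr_realpow)
    finally show ?thesis using h by simp
  qed
  have "((\<lambda>h. M * h powr (n - 2 * expo)) \<longlongrightarrow> M * 0) (at_right 0)"
  proof (intro tendsto_intros)
    have "((\<lambda>h::real. h powr (n - 2 * expo)) \<longlongrightarrow> 0 powr (n - 2 * expo)) (at_right 0)"
      using n by (intro tendsto_powr') (auto intro!: tendsto_intros exI[of _ 1] simp: eventually_at_right_field)
    then show "((\<lambda>h::real. h powr (n - 2 * expo)) \<longlongrightarrow> 0) (at_right 0)" by simp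
  qed
  moreover have "\<forall>\<^sub>F h in at_right 0. B \<le> M * h powr (n - 2 * expo)"
    unfolding eventually_at_right_field
    using d(1) e le by (intro exI[of _ "min d e"]) auto
  ultimately have "B \<le> M * 0"
    by (rule tendsto_lowerbound) simp
  then show False using B by simp
qed

end

section \<open>The free boundary problem\<close>

text \<open>Interior smoothness turns the nested \<open>deriv_on\<close> into ordinary derivatives,
  and \<open>C1_on\<close> gives continuity up to both end points.\<close>

lemma free_boundary_solution_system:
  assumes "free_boundary_solution \<alpha> \<Lambda> v0 c R v" "0 < \<Lambda>"
  obtains D :: "nat \<Rightarrow> real \<Rightarrow> real" where
    "D 0 = v"
    "\<And>k x. 0 < x \<Longrightarrow> x < R \<Longrightarrow> (D k has_real_derivative D (Suc k) x) (at x)"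
    "continuous_on {0..R} v" "continuous_on {0..R} (deriv_on R v)"
    "\<And>x. 0 < x \<Longrightarrow> x < R \<Longrightarrow> (v has_real_derivative deriv_on R v x) (at x)"
    "\<And>x. 0 < x \<Longrightarrow> x < R \<Longrightarrow>
       (deriv_on R v has_real_derivative (c * deriv_on R v x + v x powr \<alpha>) / \<Lambda>) (at x)"
proof -
  have R: "0 < R" and smooth: "Cinfinity_on {0..<R} v" and C1: "C1_on R v"
    and ode: "\<And>x. 0 < x \<Longrightarrow> x < R \<Longrightarrow>
      \<Lambda> * deriv_on R (deriv_on R v) x - c * deriv_on R v x = v x powr \<alpha>"
    using assms by (auto simp: free_boundary_solution_def admissible_def satisfies_ode_def)
  obtain D where D0: "D 0 = v"
    and D: "\<And>k x. x \<in> {0..<R} \<Longrightarrow> (D k has_real_derivative D (Suc k) x) (at x within {0..<R})"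
    using smooth unfolding Cinfinity_on_def by blast
  have D': "(D k has_real_derivative D (Suc k) x) (at x)" if "0 < x" "x < R" for k x
  proof -
    have "at x within {0..<R} = at x" by (rule at_within_interior) (use that in simp)
    then show ?thesis using D[of x k] that by simp
  qed
  have v1: "deriv_on R v x = D 1 x" if "0 < x" "x < R" for x
    using D'[of x 0] that R by (intro deriv_on_eq) (auto simp: D0 intro: DERIV_subset)
  have d1: "(deriv_on R v has_real_derivative D 2 x) (at x)" if "0 < x" "x < R" for x
    by (rule has_field_derivative_transform_within_open[of "D 1" _ _ "{0<..<R}"])
      (use D'[of x 1] that v1 in \<open>auto simp: numeral_2_eq_2\<close>)
  have v2: "deriv_on R (deriv_on R v) x = D 2 x" if "0 < x" "x < R" for x
    using d1[OF that] that R by (intro deriv_on_eq) (auto intro: DERIV_subset)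
  have "(deriv_on R v has_real_derivative (c * deriv_on R v x + v x powr \<alpha>) / \<Lambda>) (at x)"
    if x: "0 < x" "x < R" for x
  proof -
    have "D 2 x = (c * deriv_on R v x + v x powr \<alpha>) / \<Lambda>"
      using ode[OF x] assms(2) by (simp add: v2[OF x] field_simps)
    then show ?thesis using d1[OF x] by simp
  qed
  moreover have "(v has_real_derivative deriv_on R v x) (at x)" if "0 < x" "x < R" for x
    using D'[of x 0] v1[of x] that D0 by simp
  moreover have "continuous_on {0..R} v"
    using C1 unfolding C1_on_def by (auto intro: differentiable_imp_continuous_on)
  moreover have "continuous_on {0..R} (deriv_on R v)"
    using C1 unfolding C1_on_def by auto
  ultimately show thesis using that D0 D' by blast
qed

context combustion_profile begin

text \<open>With \<open>s = R - t / c\<close> and division by \<open>amp c\<close>, a solution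
  becomes a possibly delayed copy of \<open>U\<close>. Smoothness removes the delay, and the data at
  \<open>s = 0\<close> are read off at \<open>t = c * R\<close>.\<close>

lemma free_boundary_solution_char:
  assumes sol: "free_boundary_solution \<alpha> \<Lambda> v0 c R v" and v0: "0 < v0"
  shows "v0 = amp c * U (c * R)" "amp c * F (c * R) = 1"
    "\<And>s. 0 \<le> s \<Longrightarrow> s \<le> R \<Longrightarrow> v s = amp c * U (c * (R - s))"
proof -
  obtain D where D: "D 0 = v"
    "\<And>k x. 0 < x \<Longrightarrow> x < R \<Longrightarrow> (D k has_real_derivative D (Suc k) x) (at x)"
    and cont: "continuous_on {0..R} v" "continuous_on {0..R} (deriv_on R v)"
    and dv: "\<And>x. 0 < x \<Longrightarrow> x < R \<Longrightarrow> (v has_real_derivative deriv_on R v x) (at x)"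
    and ddv: "\<And>x. 0 < x \<Longrightarrow> x < R \<Longrightarrow>
       (deriv_on R v has_real_derivative (c * deriv_on R v x + v x powr \<alpha>) / \<Lambda>) (at x)"
    using free_boundary_solution_system[OF sol \<Lambda>(1)] by blast
  have c: "0 < c" and R: "0 < R" and nn: "\<And>x. 0 \<le> x \<Longrightarrow> x \<le> R \<Longrightarrow> 0 \<le> v x"
    and bc: "v 0 = v0" "deriv_on R v 0 = - (c / \<Lambda>) * (1 - v0)" "v R = 0" "deriv_on R v R = 0"
    using sol by (auto simp: free_boundary_solution_def admissible_def)
  define A where "A = amp c"
  have A: "0 < A" using amp_pos[OF c] by (simp add: A_def)
  define T where "T = c * R"
  have T: "0 < T" using c R by (simp add: T_def)
  define x where "x t = R - t / c" for t
  have x_in: "0 \<le> x t" "x t \<le> R" if "0 \<le> t" "t \<le> T" for t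
    using that c by (auto simp: x_def T_def field_simps)
  have x_in': "0 < x t" "x t < R" if "0 < t" "t < T" for t
    using that c by (auto simp: x_def T_def field_simps)
  have dx: "(x has_real_derivative - (1 / c)) (at t)" for t
    unfolding x_def using c by (auto intro!: derivative_eq_intros)
  have cx: "continuous_on {0..T} x"
    unfolding x_def using c by (auto intro!: continuous_intros)
  define u where "u t = v (x t) / A" for t
  \<comment> \<open>This is \<open>u + \<Lambda> * u'\<close>; the sign comes from the reversal of
    time.\<close>
  define y where "y t = u t - \<Lambda> / (c * A) * deriv_on R v (x t)" for t
  have cu: "continuous_on {0..T} u"
    unfolding u_def using A x_in
    by (intro continuous_intros continuous_on_compose2[OF cont(1) cx]) auto
  have cy: "continuous_on {0..T} y"
    unfolding y_def using A c x_in cu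
    by (intro continuous_intros continuous_on_compose2[OF cont(2) cx]) auto
  have u': "(u has_real_derivative - (deriv_on R v (x t) / (c * A))) (at t)"
    if "0 < t" "t < T" for t
    using DERIV_cdivide[OF DERIV_chain2[OF dv[OF x_in'[OF that]] dx], of A]
    by (simp add: u_def[abs_def])
  have prof: "profile_on T u y"
    unfolding profile_on_def
  proof (intro conjI ballI allI impI cu cy)
    fix t assume t: "0 < t" "t < T"
    have "(y t - u t) / \<Lambda> = - (deriv_on R v (x t) / (c * A))"
      using \<Lambda> by (simp add: y_def)
    then show "(u has_real_derivative (y t - u t) / \<Lambda>) (at t)"
      using u'[OF t] by simp
    have "A powr \<alpha> = c\<^sup>2 * A" unfolding A_def by (rule amp_powr[OF c])
    then have "u t powr \<alpha> = v (x t) powr \<alpha> / (c\<^sup>2 * A)"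
      using A nn[of "x t"] x_in[of t] t by (simp add: u_def powr_divide)
    also have "\<dots> = - (deriv_on R v (x t) / (c * A)) -
      \<Lambda> / (c * A) * ((c * deriv_on R v (x t) + v (x t) powr \<alpha>) / \<Lambda> * (- (1 / c)))"
      using A c \<Lambda> by (simp add: field_simps power2_eq_square)
    finally show "(y has_real_derivative u t powr \<alpha>) (at t)"
      using DERIV_diff[OF u'[OF t]
          DERIV_cmult[OF DERIV_chain2[OF ddv[OF x_in'[OF t]] dx], of "\<Lambda> / (c * A)"]]
      by (simp add: y_def[abs_def])
  next
    fix t assume "t \<in> {0..T}"
    then show "0 \<le> u t" using nn[of "x t"] x_in[of t] A by (simp add: u_def)
  qed
  have u0: "u 0 = 0" "y 0 = 0" using bc by (simp_all add: y_def u_def x_def)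
  have xT: "x T = 0" using c by (simp add: x_def T_def)
  have uT: "u T = v0 / A" using bc by (simp add: u_def xT)
  obtain \<tau> where \<tau>: "0 \<le> \<tau>" "\<tau> < T" "\<And>t. 0 \<le> t \<Longrightarrow> t \<le> \<tau> \<Longrightarrow> u t = 0"
    "\<And>t. 0 \<le> t \<Longrightarrow> t \<le> T - \<tau> \<Longrightarrow> u (t + \<tau>) = U t \<and> y (t + \<tau>) = F t"
    using profile_on_delayed[OF prof u0 T] uT v0 A by auto
  have "\<tau> = 0"
  \<comment> \<open>A positive delay would make the smooth \<open>v\<close> vanish identically
    between \<open>x \<tau>\<close> and \<open>R\<close>, while detaching at \<open>x \<tau>\<close>
    like \<open>U\<close>.\<close>
  proof (rule ccontr)
    assume "\<tau> \<noteq> 0"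
    then have \<tau>0: "0 < \<tau>" using \<tau> by simp
    have v_u: "v s = A * u (c * (R - s))" for s
      using A c by (simp add: u_def x_def)
    show False
    proof (rule smooth_not_delayed[of 0 R D "x \<tau>" A c "(T - \<tau>) / c"])
      show "0 < x \<tau>" "x \<tau> < R" using x_in' \<tau>0 \<tau> by auto
      show "D 0 s = 0" if "x \<tau> < s" "s < R" for s
      proof -
        have "c * (R - s) \<le> \<tau>" using that c by (simp add: x_def field_simps)
        then show ?thesis using \<tau>(3)[of "c * (R - s)"] that c by (simp add: D v_u)
      qed
      show "D 0 (x \<tau> - h) = A * U (c * h)" if "0 < h" "h < (T - \<tau>) / c" for h
      proof -
        have "c * (R - (x \<tau> - h)) = c * h + \<tau>" using c by (simp add: x_def algebra_simps)
        moreover have "c * h \<le> T - \<tau>" using that c by (simp add: field_simps)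
        ultimately show ?thesis using \<tau>(4)[of "c * h"] that c by (simp add: D v_u)
      qed
    qed (use D A c \<tau> in auto)
  qed
  then have eq: "u t = U t" "y t = F t" if "0 \<le> t" "t \<le> T" for t
    using \<tau>(4)[of t] that by auto
  show "v0 = amp c * U (c * R)"
    using eq(1)[of T] T uT A by (simp add: T_def A_def)
  \<comment> \<open>The flux condition at 0 enters here; the terms in \<open>v0\<close>
    cancel.\<close>
  have "F T = v0 / A - \<Lambda> / (c * A) * (- (c / \<Lambda>) * (1 - v0))"
    using eq(2)[of T] T uT bc by (simp add: y_def xT)
  also have "\<dots> = 1 / A" using A c \<Lambda> by (simp add: field_simps)
  finally show "amp c * F (c * R) = 1" using A by (simp add: T_def A_def)
  show "v s = amp c * U (c * (R - s))" if "0 \<le> s" "s \<le> R" for s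
  proof -
    have "0 \<le> c * (R - s)" "c * (R - s) \<le> T" using that c by (auto simp: T_def)
    then show ?thesis
      using eq(1)[of "c * (R - s)"] A c by (simp add: u_def x_def A_def field_simps)
  qed
qed

text \<open>The ratio \<open>U / F\<close> at \<open>c * R\<close> equals \<open>v0\<close>, which
  fixes \<open>c * R\<close>; then \<open>amp c * F (c * R) = 1\<close> fixes \<open>amp c\<close>,
  hence \<open>c\<close>, \<open>R\<close> and the profile.\<close>

lemma free_boundary_solution_unique:
  assumes 1: "free_boundary_solution \<alpha> \<Lambda> v0 c R v" "\<And>x. x \<notin> {0..R} \<Longrightarrow> v x = 0"
    and 2: "free_boundary_solution \<alpha> \<Lambda> v0 d S w" "\<And>x. x \<notin> {0..S} \<Longrightarrow> w x = 0"
    and v0: "0 < v0"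
  shows "c = d" "R = S" "v = w"
proof -
  have pos: "0 < c" "0 < R" "0 < d" "0 < S"
    using 1 2 by (auto simp: free_boundary_solution_def admissible_def)
  have ratio: "U (k * r) / F (k * r) = v0"
    if "v0 = amp k * U (k * r)" "amp k * F (k * r) = 1" "0 < k" for k r
  proof -
    have "F (k * r) = 1 / amp k" using that amp_pos[of k] by (simp add: field_simps)
    then show ?thesis using that by simp
  qed
  note char1 = free_boundary_solution_char[OF 1(1) v0]
  note char2 = free_boundary_solution_char[OF 2(1) v0]
  have \<rho>: "c * R = d * S"
    using ratio_strict_mono[of "c * R" "d * S"] ratio_strict_mono[of "d * S" "c * R"]
      ratio[OF char1(1,2)] ratio[OF char2(1,2)] pos
    by (cases "c * R" "d * S" rule: linorder_cases) auto
  have "amp c = amp d"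
    using char1(2) char2(2) F_pos[of "d * S"] pos unfolding \<rho>
    by (metis mult_pos_pos mult_right_cancel less_irrefl)
  then show "c = d" using amp_inj pos by simp
  with \<rho> show "R = S" using pos by simp
  show "v = w"
  proof
    fix s
    show "v s = w s"
      using char1(3)[of s] char2(3)[of s] 1(2)[of s] 2(2)[of s] \<open>c = d\<close> \<open>R = S\<close>
      by (cases "s \<in> {0..R}") auto
  qed
qed

lemma the_solution_eq:
  assumes "free_boundary_solution \<alpha> \<Lambda> v0 c R v" "\<And>x. x \<notin> {0..R} \<Longrightarrow> v x = 0" "0 < v0"
  shows "the_solution \<alpha> \<Lambda> v0 = (c, R, v)"
  unfolding the_solution_def
proof (rule the_equality)
  show "case (c, R, v) of (c, R, v) \<Rightarrow>
      free_boundary_solution \<alpha> \<Lambda> v0 c R v \<and> (\<forall>x. x \<notin> {0..R} \<longrightarrow> v x = 0)"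
    using assms by simp
  fix p :: "real \<times> real \<times> (real \<Rightarrow> real)"
  assume p: "case p of (c, R, v) \<Rightarrow>
      free_boundary_solution \<alpha> \<Lambda> v0 c R v \<and> (\<forall>x. x \<notin> {0..R} \<longrightarrow> v x = 0)"
  obtain d S w where "p = (d, S, w)" by (cases p)
  with p show "p = (c, R, v)"
    using free_boundary_solution_unique[OF assms(1,2) _ _ assms(3), of d S w] by auto
qed

section \<open>Explicit solutions built from the profile\<close>

definition wave :: "real \<Rightarrow> real \<Rightarrow> real \<Rightarrow> real" where
  "wave c R s = (if s \<in> {0..R} then amp c * U (c * (R - s)) else 0)"

lemma
  assumes c: "0 < c" and R: "0 < R" and s: "0 \<le> s" "s \<le> R"
  shows wave_has_deriv:
      "(wave c R has_real_derivative - (c * amp c * U1 (c * (R - s)))) (at s within {0..R})"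
    and deriv_on_wave: "deriv_on R (wave c R) s = - (c * amp c * U1 (c * (R - s)))"
proof -
  have "((\<lambda>s. amp c * U (c * (R - s))) has_real_derivative
      amp c * (U1 (c * (R - s)) * (c * (0 - 1)))) (at s)"
    by (intro DERIV_cmult DERIV_chain2[OF U_has_deriv] DERIV_diff DERIV_const DERIV_ident)
  then have "((\<lambda>s. amp c * U (c * (R - s))) has_real_derivative
      - (c * amp c * U1 (c * (R - s)))) (at s within {0..R})"
    by (auto intro: DERIV_subset simp: mult_ac)
  then show d: "(wave c R has_real_derivative - (c * amp c * U1 (c * (R - s)))) (at s within {0..R})"
    by (rule has_field_derivative_transform_within[where d = 1]) (use s in \<open>auto simp: wave_def\<close>)
  show "deriv_on R (wave c R) s = - (c * amp c * U1 (c * (R - s)))"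
    by (rule deriv_on_eq[OF d R s])
qed

lemma deriv_on_deriv_on_wave:
  assumes c: "0 < c" and R: "0 < R" and s: "0 \<le> s" "s \<le> R"
  shows "deriv_on R (deriv_on R (wave c R)) s =
    c\<^sup>2 * amp c * ((U (c * (R - s)) powr \<alpha> - U1 (c * (R - s))) / \<Lambda>)"
proof (rule deriv_on_eq[OF _ R s])
  let ?t = "c * (R - s)"
  have "((\<lambda>s. - (c * amp c * U1 (c * (R - s)))) has_real_derivative
      - (c * amp c * (((U ?t powr \<alpha> - U1 ?t) / \<Lambda>) * (c * (0 - 1))))) (at s)"
    by (intro DERIV_cmult DERIV_minus DERIV_chain2[OF U1_deriv] DERIV_diff DERIV_const DERIV_ident)
  moreover have "- (c * amp c * (((U ?t powr \<alpha> - U1 ?t) / \<Lambda>) * (c * (0 - 1)))) =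
      c\<^sup>2 * amp c * ((U ?t powr \<alpha> - U1 ?t) / \<Lambda>)"
    by (simp add: power2_eq_square)
  ultimately have "((\<lambda>s. - (c * amp c * U1 (c * (R - s)))) has_real_derivative
      c\<^sup>2 * amp c * ((U ?t powr \<alpha> - U1 ?t) / \<Lambda>)) (at s within {0..R})"
    by (metis DERIV_subset subset_UNIV)
  then show "(deriv_on R (wave c R) has_real_derivative
      c\<^sup>2 * amp c * ((U ?t powr \<alpha> - U1 ?t) / \<Lambda>)) (at s within {0..R})"
    by (rule has_field_derivative_transform_within[where d = 1])
      (use s deriv_on_wave[OF c R] in auto)
qed

lemma wave_smooth:
  assumes c: "0 < c" and R: "0 < R"
  shows "Cinfinity_on {0..<R} (wave c R)"
proof -
  obtain D where D0: "D 0 = U"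
    and D: "\<And>k t. 0 < t \<Longrightarrow> (D k has_real_derivative D (Suc k) t) (at t)"
    using U_smooth by blast
  define G where "G k s = amp c * (- c) ^ k * D k (c * (R - s))" for k s
  have G: "(G k has_real_derivative G (Suc k) s) (at s)" if "s < R" for k s
  proof -
    have "0 < c * (R - s)" using that c by simp
    then have "(G k has_real_derivative amp c * (- c) ^ k * (D (Suc k) (c * (R - s)) * (c * (0 - 1)))) (at s)"
      unfolding G_def [abs_def]
      by (intro DERIV_cmult DERIV_chain2[OF D] DERIV_diff DERIV_const DERIV_ident)
    then show ?thesis by (simp add: G_def mult_ac)
  qed
  \<comment> \<open>\<open>G 0\<close> agrees with the wave on \<open>{0..R}\<close> only, whereas
    the sequence has to start with the total function.\<close>
  define E where "E k = (if k = 0 then wave c R else G k)" for k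
  have "(E k has_real_derivative E (Suc k) s) (at s within {0..<R})" if s: "s \<in> {0..<R}" for k s
    by (rule has_field_derivative_transform_within[where d = 1 and f = "G k"])
      (use s G[of s k] in \<open>auto simp: E_def G_def D0 wave_def intro: DERIV_subset\<close>)
  then show ?thesis
    unfolding Cinfinity_on_def by (intro exI[of _ E]) (simp add: E_def)
qed

lemma wave_solution:
  assumes c: "0 < c" and R: "0 < R" and F: "amp c * F (c * R) = 1"
  shows "free_boundary_solution \<alpha> \<Lambda> (amp c * U (c * R)) c R (wave c R)"
proof -
  have A: "0 < amp c" using amp_pos[OF c] .
  have "C1_on R (wave c R)"
    unfolding C1_on_def
  proof
    show "wave c R differentiable_on {0..R}"
      unfolding differentiable_on_def
      using wave_has_deriv[OF c R] real_differentiable_def by force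
    have "continuous_on {0..R} (\<lambda>s. - (c * amp c * U1 (c * (R - s))))"
      by (intro continuous_intros continuous_on_compose2[OF U1_continuous[of UNIV]]) auto
    then show "continuous_on {0..R} (deriv_on R (wave c R))"
      using deriv_on_wave[OF c R] by (subst continuous_on_cong[OF refl]) auto
  qed
  moreover have "0 \<le> wave c R s" if "s \<in> {0..R}" for s
    using that A c U_nonneg[of "c * (R - s)"] by (simp add: wave_def)
  ultimately have "admissible c R (wave c R)"
    using c R wave_smooth[OF c R] by (simp add: admissible_def)
  moreover have "satisfies_ode \<alpha> \<Lambda> c R (wave c R)"
    unfolding satisfies_ode_def
  proof
    fix s assume s: "s \<in> {0<..<R}"
    let ?t = "c * (R - s)"
    have "\<Lambda> * deriv_on R (deriv_on R (wave c R)) s - c * deriv_on R (wave c R) s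
        = c\<^sup>2 * amp c * U ?t powr \<alpha>"
      using s \<Lambda> by (simp add: deriv_on_deriv_on_wave[OF c R] deriv_on_wave[OF c R]
          power2_eq_square algebra_simps diff_divide_distrib)
    also have "\<dots> = wave c R s powr \<alpha>"
      using s c A U_nonneg[of ?t] by (simp add: wave_def powr_mult amp_powr)
    finally show "\<Lambda> * deriv_on R (deriv_on R (wave c R)) s - c * deriv_on R (wave c R) s
        = wave c R s powr \<alpha>" .
  qed
  moreover have "deriv_on R (wave c R) 0 = - (c / \<Lambda>) * (1 - amp c * U (c * R))"
  proof -
    have "1 - amp c * U (c * R) = \<Lambda> * amp c * U1 (c * R)"
      using F by (simp add: F_eq algebra_simps)
    then show ?thesis using \<Lambda> R by (simp add: deriv_on_wave[OF c R])
  qed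
  ultimately show ?thesis
    using R by (simp add: free_boundary_solution_def deriv_on_wave[OF c R] U1_0)
      (simp add: wave_def U_0)
qed

text \<open>\<open>exp (- c * s)\<close> splits into \<open>exp (- (c * R))\<close> and
  \<open>exp (c * (R - s))\<close>, so \<open>W (c * (R - s))\<close> yields an antiderivative that
  vanishes at \<open>s = R\<close>.\<close>

lemma wave_integral:
  assumes c: "0 < c" and R: "0 < R"
  shows "((\<lambda>s. exp (- c * s) * deriv_on R (wave c R) s)
    has_integral - (amp c * (exp (- (c * R)) * W (c * R)))) {0..R}"
proof -
  let ?G = "\<lambda>s. amp c * exp (- (c * R)) * W (c * (R - s))"
  have "((\<lambda>s. exp (- c * s) * deriv_on R (wave c R) s) has_integral ?G R - ?G 0) {0..R}"
  proof (rule fundamental_theorem_of_calculus)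
    fix s assume s: "s \<in> {0..R}"
    let ?t = "c * (R - s)"
    have "(?G has_real_derivative amp c * exp (- (c * R)) * (exp ?t * U1 ?t * (c * (0 - 1)))) (at s)"
      by (intro DERIV_cmult DERIV_chain2[OF W_deriv] DERIV_diff DERIV_const DERIV_ident)
    moreover have "amp c * exp (- (c * R)) * (exp ?t * U1 ?t * (c * (0 - 1)))
        = exp (- c * s) * deriv_on R (wave c R) s"
    proof -
      have "exp (- (c * R)) * exp ?t = exp (- c * s)"
        by (simp add: exp_add[symmetric] algebra_simps)
      then show ?thesis using s by (simp add: deriv_on_wave[OF c R])
    qed
    ultimately show "(?G has_vector_derivative exp (- c * s) * deriv_on R (wave c R) s)
        (at s within {0..R})"
      by (metis has_real_derivative_iff_has_vector_derivative has_vector_derivative_at_within)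
  qed (use R in simp)
  then show ?thesis by (simp add: W_0 mult.assoc)
qed

lemma fixed_point_exists:
  assumes \<theta>: "0 < \<theta>" "\<theta> < 1"
  shows "\<exists>v0\<in>{1 - \<theta>..1 - \<Lambda> * \<theta>}. Phi \<alpha> \<Lambda> \<theta> v0 = v0 \<and> sol_v \<alpha> \<Lambda> v0 0 = v0 \<and>
    integro_differential_solution \<alpha> \<Lambda> \<theta> (sol_c \<alpha> \<Lambda> v0) (sol_R \<alpha> \<Lambda> v0) (sol_v \<alpha> \<Lambda> v0)"
proof -
  obtain \<rho> where \<rho>: "0 < \<rho>"
    and bal: "U \<rho> - (1 - \<Lambda>) * (exp (- \<rho>) * W \<rho>) = (1 - \<theta>) * F \<rho>"
    using exists_balance[OF \<theta>] by blast
  have F: "0 < F \<rho>" using F_pos \<rho> .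
  \<comment> \<open>Inverts \<open>amp\<close> so that \<open>amp c * F \<rho> = 1\<close>;
    \<open>R\<close> is then forced by \<open>c * R = \<rho>\<close>.\<close>
  define c where "c = (1 / F \<rho>) powr (- 1 / (2 * expo))"
  define R where "R = \<rho> / c"
  have c: "0 < c" using F by (simp add: c_def)
  have A: "amp c = 1 / F \<rho>" unfolding c_def using F by (intro amp_surj) simp
  have R: "0 < R" using c \<rho> by (simp add: R_def)
  have cR: "c * R = \<rho>" using c by (simp add: R_def)
  define v0 where "v0 = amp c * U \<rho>"
  define J where "J = amp c * (exp (- \<rho>) * W \<rho>)"
  have v0_eq: "v0 = 1 - \<theta> + (1 - \<Lambda>) * J"
  proof -
    have "v0 - (1 - \<Lambda>) * J = amp c * (U \<rho> - (1 - \<Lambda>) * (exp (- \<rho>) * W \<rho>))"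
      by (simp add: v0_def J_def algebra_simps)
    also have "\<dots> = 1 - \<theta>" using F by (simp add: bal A)
    finally show ?thesis by simp
  qed
  have "0 \<le> J" using amp_pos[OF c] W_nonneg[of \<rho>] \<rho> by (simp add: J_def)
  then have lower: "1 - \<theta> \<le> v0" using \<Lambda> by (simp add: v0_eq)
  \<comment> \<open>From \<open>W_upper\<close>, \<open>\<Lambda> * J \<le> 1 - v0\<close>;
    inserting this into \<open>v0_eq\<close> multiplied by \<Lambda> and collecting
    \<open>v0\<close> gives the bound.\<close>
  have upper: "v0 \<le> 1 - \<Lambda> * \<theta>"
  proof -
    have "J \<le> amp c * U1 \<rho>"
      unfolding J_def using amp_pos[OF c] W_upper[of \<rho>] \<rho> by (intro mult_left_mono) auto
    then have "\<Lambda> * J \<le> \<Lambda> * (amp c * U1 \<rho>)" using \<Lambda> by (intro mult_left_mono) auto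
    also have "\<dots> = 1 - v0"
    proof -
      have "1 = amp c * F \<rho>" using F by (simp add: A)
      then show ?thesis by (simp add: v0_def F_eq algebra_simps)
    qed
    finally have "(1 - \<Lambda>) * (\<Lambda> * J) \<le> (1 - \<Lambda>) * (1 - v0)" using \<Lambda> by (intro mult_left_mono) auto
    then have "\<Lambda> * v0 \<le> \<Lambda> * (1 - \<theta>) + (1 - \<Lambda>) * (1 - v0)"
      by (simp add: v0_eq algebra_simps)
    then show ?thesis by (simp add: algebra_simps)
  qed
  have v0_pos: "0 < v0" "v0 < 1"
  proof -
    show "0 < v0" using lower \<theta> by simp
    have "0 < \<Lambda> * \<theta>" using \<Lambda> \<theta> by simp
    then show "v0 < 1" using upper by simp
  qed
  have sol: "free_boundary_solution \<alpha> \<Lambda> v0 c R (wave c R)"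
    using wave_solution[OF c R] F by (simp add: cR A v0_def)
  have "the_solution \<alpha> \<Lambda> v0 = (c, R, wave c R)"
    using sol v0_pos by (intro the_solution_eq) (auto simp: wave_def)
  then have sel: "sol_c \<alpha> \<Lambda> v0 = c" "sol_R \<alpha> \<Lambda> v0 = R" "sol_v \<alpha> \<Lambda> v0 = wave c R"
    by (simp_all add: sol_c_def sol_R_def sol_v_def)
  have int: "integral {0..R} (\<lambda>s. exp (- c * s) * deriv_on R (wave c R) s) = - J"
    using wave_integral[OF c R] by (simp add: integral_unique cR J_def)
  then have "integral {0..R} (\<lambda>s. exp (- c * s) * (- deriv_on R (wave c R) s)) = J"
    by simp
  then have "Phi \<alpha> \<Lambda> \<theta> v0 = interval_proj (1 - \<theta>) (1 - \<Lambda> * \<theta>) v0"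
    unfolding Phi_def sel by (simp only: v0_eq)
  then have "Phi \<alpha> \<Lambda> \<theta> v0 = v0"
    using lower upper by (simp add: interval_proj_def)
  moreover have w0: "wave c R 0 = v0"
    using sol by (simp add: free_boundary_solution_def)
  moreover have "integro_differential_solution \<alpha> \<Lambda> \<theta> c R (wave c R)"
  proof -
    have "\<theta> + v0 = 1 - (1 - \<Lambda>) * integral {0..R} (\<lambda>s. exp (- c * s) * deriv_on R (wave c R) s)"
      unfolding int by (simp add: v0_eq)
    then show ?thesis
      using sol v0_pos w0
      unfolding free_boundary_solution_def integro_differential_solution_def by simp
  qed
  ultimately show ?thesis
    using lower upper by (intro bexI[of _ v0]) (auto simp: sel)
qed

end

lemma (in combustion) combustion_profile_exists: "\<exists>U F. combustion_profile \<alpha> \<Lambda> U F"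
proof -
  obtain U F :: "real \<Rightarrow> real" where
    "\<And>t. (U has_real_derivative (F t - U t) / \<Lambda>) (at t)"
    "\<And>t. (F has_real_derivative U t powr \<alpha>) (at t)"
    "U 0 = 0" "F 0 = 0"
    "\<And>t. 0 < t \<Longrightarrow> 0 < U t"
    "\<And>T. 0 \<le> T \<Longrightarrow> \<exists>k>0. \<forall>t\<in>{0..T}. barrier k t \<le> U t"
    using profile_exists by blast
  then have "combustion_profile \<alpha> \<Lambda> U F"
    by unfold_locales
  then show ?thesis by blast
qed

theorem theorem7p4:
  fixes \<alpha> \<theta> \<Lambda> :: real
  assumes "0 < \<alpha>" "\<alpha> < 1" "0 < \<theta>" "\<theta> < 1" "0 < \<Lambda>" "\<Lambda> < 1"
  shows "Phi \<alpha> \<Lambda> \<theta> \<in> {1 - \<theta>..1 - \<Lambda> * \<theta>} \<rightarrow> {1 - \<theta>..1 - \<Lambda> * \<theta>} \<and>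
    (\<exists>v0\<in>{1 - \<theta>..1 - \<Lambda> * \<theta>}.
      Phi \<alpha> \<Lambda> \<theta> v0 = v0 \<and>
      sol_v \<alpha> \<Lambda> v0 0 = v0 \<and>
      integro_differential_solution \<alpha> \<Lambda> \<theta>
        (sol_c \<alpha> \<Lambda> v0) (sol_R \<alpha> \<Lambda> v0) (sol_v \<alpha> \<Lambda> v0))"
proof
  \<comment> \<open>Orders the end points, so that the projection lands in the interval.\<close>
  have "\<Lambda> * \<theta> \<le> 1 * \<theta>" using assms by (intro mult_right_mono) auto
  then show "Phi \<alpha> \<Lambda> \<theta> \<in> {1 - \<theta>..1 - \<Lambda> * \<theta>} \<rightarrow> {1 - \<theta>..1 - \<Lambda> * \<theta>}"
    by (auto simp: Phi_def interval_proj_def)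
  interpret combustion \<alpha> \<Lambda> using assms by unfold_locales
  obtain U F where "combustion_profile \<alpha> \<Lambda> U F"
    using combustion_profile_exists by blast
  then interpret combustion_profile \<alpha> \<Lambda> U F .
  show "\<exists>v0\<in>{1 - \<theta>..1 - \<Lambda> * \<theta>}. Phi \<alpha> \<Lambda> \<theta> v0 = v0 \<and> sol_v \<alpha> \<Lambda> v0 0 = v0 \<and>
      integro_differential_solution \<alpha> \<Lambda> \<theta>
        (sol_c \<alpha> \<Lambda> v0) (sol_R \<alpha> \<Lambda> v0) (sol_v \<alpha> \<Lambda> v0)"
    using fixed_point_exists assms by simp
qed

end
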